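(* For every finite group $G$ and every integer $n\ge 1$, the $\mathbb{Z}$-module homomorphism $\Psi:\mathcal{SC}_n(G)\to\mathcal{SC}_n(G)$ descends to the respective quotients of the combinatorial symbols group: there is a homomorphism of abelian groups $\Psi:\mathcal{BC}_n(G)\to\mathcal{BC}_n'(G)$ such that the composition of $\Psi:\mathcal{SC}_n(G)\to\mathcal{SC}_n(G)$ with the quotient map $\mathcal{SC}_n(G)\to\mathcal{BC}'_n(G)$ equals the composition of the quotient map $\mathcal{SC}_n(G)\to\mathcal{BC}_n(G)$ with $\Psi:\mathcal{BC}_n(G)\to\mathcal{BC}_n'(G)$. Moreover, $\Psi:\mathcal{BC}_n(G)\to\mathcal{BC}_n'(G)$ is an isomorphism, whose inverse is given by $\Phi$ (that is, it is induced by the homomorphism $\Phi:\mathcal{SC}_n(G)\to\mathcal{SC}_n(G)$).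
   Context: Let $G$ be a finite group and $n\ge 1$ an integer. For a finite abelian group $H$, $H^\vee=\mathrm{Hom}(H,\mathbb{C}^\times)$ is its character group, written additively. **Symbols group.** $\mathcal{SC}_n(G)$ is the $\mathbb{Z}$-module generated by triples (symbols) $(H,Y,\beta)$, where $H\subseteq G$ is an abelian subgroup, $Y\subseteq G$ is a subgroup with $H\subseteq Y\subseteq Z_G(H)$ (the centralizer of $H$ in $G$), and $\beta=(b_1,\dots,b_r)$ is a sequence of nontrivial (nonzero) characters of $H$, of length $r=r(\beta)$ with $1\le r\le n$, which generate $H^\vee$; subject only to the reordering relation (O): $(H,Y,(b_1,\dots,b_r))=(H,Y,(b_{\sigma(1)},\dots,b_{\sigma(r)}))$ for all $\sigma\in\mathfrak{S}_r$. For a subgroup $H'\subseteq H$, $\beta|_{H'}=(b_1|_{H'},\dots,b_r|_{H'})$. Convention: if a sequence of characters occurring in a symbol contains a zero (trivial character), that symbol is considered to be zero. **Combinatorial Burnside group.** $\mathcal{BC}_n(G)$ is the quotient of $\mathcal{SC}_n(G)$ by the relations (C), (V), (B2): - (C) $(H,Y,\beta)=(gHg^{-1},gYg^{-1},\beta^g)$ for all $g\in G$, where $\beta^g$ is the image of $\beta$ under conjugation by $g$. - (V) $(H,Y,\beta)=0$ if $H=1$, or if $b_i+b_j=0$ for some two entries $b_i,b_j$ ($i\ne j$) of $\beta$. - (B2) For $\beta=(b_1,\dots,b_r)$ with $r\ge 2$: if $b_1=b_2$, then $(H,Y,(b_1,b_2,\dots,b_r))=(H,Y,(b_2,\dots,b_r))$.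 If $b_1\ne b_2$, put $\beta_1=(b_1-b_2,b_2,b_3,\dots,b_r)$, $\beta_2=(b_1,b_2-b_1,b_3,\dots,b_r)$, $\bar H=\ker(b_1-b_2)\subseteq H$, $\bar\beta=\beta|_{\bar H}$; then $$(H,Y,\beta)=\begin{cases}(H,Y,\beta_1)+(H,Y,\beta_2) & \text{if } b_i\in\langle b_1-b_2\rangle\text{ for some } i,\\ (H,Y,\beta_1)+(H,Y,\beta_2)+(\bar H,Y,\bar\beta) & \text{otherwise.}\end{cases}$$ **Modified group.** $\mathcal{BC}'_n(G)$ is the quotient of $\mathcal{SC}_n(G)$ by the same relations (C), (V), together with - (B2') For $\beta=(b_1,\dots,b_r)$ with $r\ge 2$: if $b_1=b_2$, then $(H,Y,(b_1,b_2,\dots,b_r))=(H,Y,(b_2,\dots,b_r))$; if $b_1\neq b_2$, then $(H,Y,\beta)=(H,Y,\beta_1)+(H,Y,\beta_2)$ with $\beta_1,\beta_2$ as in (B2). A symbol is written $(H,Y,\beta)'$ when it is viewed as an element of $\mathcal{BC}'_n(G)$ (or of the copy of $\mathcal{SC}_n(G)$ mapping onto $\mathcal{BC}'_n(G)$). **The maps.** Let $\mu$ be the Moebius function of the poset $\mathcal{H}$ of abelian subgroups of $G$ ordered by inclusion: $\mu(H,H)=1$; $\mu(H',H)=0$ if $H'\not\subseteq H$; $\mu(H'',H)=-\sum_{H''\subseteq H'\subsetneq H}\mu(H'',H')$ if $H''\subsetneq H$. The homomorphisms $\Psi,\Phi:\mathcal{SC}_n(G)\to\mathcal{SC}_n(G)$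 are defined on symbols by $$\Psi:(H,Y,\beta)\mapsto\sum_{H'\subseteq H}(H',Y,\beta|_{H'})',\qquad \Phi:(H,Y,\beta)'\mapsto\sum_{H'\subseteq H}\mu(H',H)\,(H',Y,\beta|_{H'}),$$ the sums being over all subgroups $H'$ of $H$, with the zero convention above, and extended by $\mathbb{Z}$-linearity. *)

theory Defs
  imports
    Complex_Main
    "HOL-Algebra.Free_Abelian_Groups"
    "HOL-Combinatorics.Permutations"
begin

section \<open>Character groups\<close>

definition complex_units :: "complex monoid" where
  "complex_units = \<lparr>carrier = UNIV - {0}, monoid.mult = (*), one = 1\<rparr>"

text \<open>
  Character groups are written multiplicatively here, though usually additively: the zero character
  is \<open>\<one>\<close>, and \<open>b\<^sub>1 - b\<^sub>2\<close> is \<open>b\<^sub>1 \<otimes> inv b\<^sub>2\<close>. Characters are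
  extensional functions, so that equality of characters is equality on the group.
\<close>

definition char_group :: "('a, 'b) monoid_scheme \<Rightarrow> ('a \<Rightarrow> complex) monoid" where
  "char_group K =
    \<lparr>carrier = hom K complex_units \<inter> extensional (carrier K),
     monoid.mult = (\<lambda>b c. \<lambda>x\<in>carrier K. b x * c x),
     one = (\<lambda>x\<in>carrier K. 1)\<rparr>"

abbreviation dual :: "('a, 'b) monoid_scheme \<Rightarrow> 'a set \<Rightarrow> ('a \<Rightarrow> complex) monoid" where
  "dual G H \<equiv> char_group (G\<lparr>carrier := H\<rparr>)"

definition char_minus ::
  "('a, 'b) monoid_scheme \<Rightarrow> 'a set \<Rightarrow> ('a \<Rightarrow> complex) \<Rightarrow> ('a \<Rightarrow> complex) \<Rightarrow> 'a \<Rightarrow> complex" where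
  "char_minus G H b c = b \<otimes>\<^bsub>dual G H\<^esub> inv\<^bsub>dual G H\<^esub> c"

definition restrict_chars :: "('a \<Rightarrow> complex) list \<Rightarrow> 'a set \<Rightarrow> ('a \<Rightarrow> complex) list" where
  "restrict_chars \<beta> H' = map (\<lambda>b. restrict b H') \<beta>"


section \<open>Symbols\<close>

definition abelian_subgroups :: "('a, 'b) monoid_scheme \<Rightarrow> 'a set set" where
  "abelian_subgroups G = {H. subgroup H G \<and> comm_group (G\<lparr>carrier := H\<rparr>)}"

definition centralizer :: "('a, 'b) monoid_scheme \<Rightarrow> 'a set \<Rightarrow> 'a set" where
  "centralizer G H = {g \<in> carrier G. \<forall>h\<in>H. g \<otimes>\<^bsub>G\<^esub> h = h \<otimes>\<^bsub>G\<^esub> g}"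

type_synonym 'a symb = "'a set \<times> 'a set \<times> ('a \<Rightarrow> complex) list"

definition symbols :: "('a, 'b) monoid_scheme \<Rightarrow> nat \<Rightarrow> 'a symb set" where
  "symbols G n = {(H, Y, \<beta>).
     H \<in> abelian_subgroups G \<and>
     subgroup Y G \<and> H \<subseteq> Y \<and> Y \<subseteq> centralizer G H \<and>
     1 \<le> length \<beta> \<and> length \<beta> \<le> n \<and>
     set \<beta> \<subseteq> carrier (dual G H) - {\<one>\<^bsub>dual G H\<^esub>} \<and>
     generate (dual G H) (set \<beta>) = carrier (dual G H)}"

text \<open>
  The class of a symbol in the free abelian group, with the convention that a symbol containing
  the zero character is zero.
\<close>

definition symb :: "('a, 'b) monoid_scheme \<Rightarrow> 'a set \<Rightarrow> 'a set \<Rightarrow> ('a \<Rightarrow> complex) list \<Rightarrow> 'a symb \<Rightarrow>\<^sub>0 int" where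
  "symb G H Y \<beta> = (if \<one>\<^bsub>dual G H\<^esub> \<in> set \<beta> then 0 else frag_of (H, Y, \<beta>))"

abbreviation free_symbols :: "('a, 'b) monoid_scheme \<Rightarrow> nat \<Rightarrow> ('a symb \<Rightarrow>\<^sub>0 int) monoid" where
  "free_symbols G n \<equiv> free_Abelian_group (symbols G n)"


section \<open>The symbols group\<close>

text \<open>
  Each set of relations \<open>rel_X\<close> consists of the differences (left-hand side minus
  right-hand side) in the free abelian group on the symbols.
\<close>

definition rel_O :: "('a, 'b) monoid_scheme \<Rightarrow> nat \<Rightarrow> ('a symb \<Rightarrow>\<^sub>0 int) set" where
  "rel_O G n = {symb G H Y \<beta> - symb G H Y (permute_list \<sigma> \<beta>) | H Y \<beta> \<sigma>.
     (H, Y, \<beta>) \<in> symbols G n \<and> \<sigma> permutes {..<length \<beta>}}"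

definition O_subgroup :: "('a, 'b) monoid_scheme \<Rightarrow> nat \<Rightarrow> ('a symb \<Rightarrow>\<^sub>0 int) set" where
  "O_subgroup G n = generate (free_symbols G n) (rel_O G n)"

definition SC :: "('a, 'b) monoid_scheme \<Rightarrow> nat \<Rightarrow> ('a symb \<Rightarrow>\<^sub>0 int) set monoid" where
  "SC G n = free_symbols G n Mod O_subgroup G n"

definition proj_SC ::
  "('a, 'b) monoid_scheme \<Rightarrow> nat \<Rightarrow> ('a symb \<Rightarrow>\<^sub>0 int) \<Rightarrow> ('a symb \<Rightarrow>\<^sub>0 int) set" where
  "proj_SC G n x = O_subgroup G n #>\<^bsub>free_symbols G n\<^esub> x"


section \<open>The combinatorial Burnside group and its modification\<close>

definition conj_set :: "('a, 'b) monoid_scheme \<Rightarrow> 'a \<Rightarrow> 'a set \<Rightarrow> 'a set" where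
  "conj_set G g H = (\<lambda>h. g \<otimes>\<^bsub>G\<^esub> h \<otimes>\<^bsub>G\<^esub> inv\<^bsub>G\<^esub> g) ` H"

definition conj_char ::
  "('a, 'b) monoid_scheme \<Rightarrow> 'a \<Rightarrow> 'a set \<Rightarrow> ('a \<Rightarrow> complex) \<Rightarrow> 'a \<Rightarrow> complex" where
  "conj_char G g H b = (\<lambda>x\<in>conj_set G g H. b (inv\<^bsub>G\<^esub> g \<otimes>\<^bsub>G\<^esub> x \<otimes>\<^bsub>G\<^esub> g))"

definition rel_C :: "('a, 'b) monoid_scheme \<Rightarrow> nat \<Rightarrow> ('a symb \<Rightarrow>\<^sub>0 int) set" where
  "rel_C G n =
    {symb G H Y \<beta> - symb G (conj_set G g H) (conj_set G g Y) (map (conj_char G g H) \<beta>) | H Y \<beta> g.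
     (H, Y, \<beta>) \<in> symbols G n \<and> g \<in> carrier G}"

definition rel_V :: "('a, 'b) monoid_scheme \<Rightarrow> nat \<Rightarrow> ('a symb \<Rightarrow>\<^sub>0 int) set" where
  "rel_V G n = {symb G H Y \<beta> | H Y \<beta>.
     (H, Y, \<beta>) \<in> symbols G n \<and>
     (H = {\<one>\<^bsub>G\<^esub>} \<or>
      (\<exists>i<length \<beta>. \<exists>j<length \<beta>. i \<noteq> j \<and> \<beta> ! i \<otimes>\<^bsub>dual G H\<^esub> \<beta> ! j = \<one>\<^bsub>dual G H\<^esub>))}"

definition blowup_terms ::
  "('a, 'b) monoid_scheme \<Rightarrow> 'a set \<Rightarrow> 'a set \<Rightarrow> ('a \<Rightarrow> complex) \<Rightarrow> ('a \<Rightarrow> complex) \<Rightarrow>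
   ('a \<Rightarrow> complex) list \<Rightarrow> 'a symb \<Rightarrow>\<^sub>0 int" where
  "blowup_terms G H Y b1 b2 bs =
     symb G H Y (char_minus G H b1 b2 # b2 # bs) + symb G H Y (b1 # char_minus G H b2 b1 # bs)"

definition rel_B2 :: "('a, 'b) monoid_scheme \<Rightarrow> nat \<Rightarrow> ('a symb \<Rightarrow>\<^sub>0 int) set" where
  "rel_B2 G n = {symb G H Y (b1 # b2 # bs) -
     (if b1 = b2 then symb G H Y (b2 # bs)
      else if \<exists>b\<in>set (b1 # b2 # bs). b \<in> generate (dual G H) {char_minus G H b1 b2}
      then blowup_terms G H Y b1 b2 bs
      else
        let H' = kernel (G\<lparr>carrier := H\<rparr>) complex_units (char_minus G H b1 b2)
        in blowup_terms G H Y b1 b2 bs + symb G H' Y (restrict_chars (b1 # b2 # bs) H'))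
     | H Y b1 b2 bs. (H, Y, b1 # b2 # bs) \<in> symbols G n}"

definition rel_B2' :: "('a, 'b) monoid_scheme \<Rightarrow> nat \<Rightarrow> ('a symb \<Rightarrow>\<^sub>0 int) set" where
  "rel_B2' G n = {symb G H Y (b1 # b2 # bs) -
     (if b1 = b2 then symb G H Y (b2 # bs) else blowup_terms G H Y b1 b2 bs)
     | H Y b1 b2 bs. (H, Y, b1 # b2 # bs) \<in> symbols G n}"

definition BC_subgroup :: "('a, 'b) monoid_scheme \<Rightarrow> nat \<Rightarrow> ('a symb \<Rightarrow>\<^sub>0 int) set set" where
  "BC_subgroup G n = generate (SC G n) (proj_SC G n ` (rel_C G n \<union> rel_V G n \<union> rel_B2 G n))"

definition BC'_subgroup :: "('a, 'b) monoid_scheme \<Rightarrow> nat \<Rightarrow> ('a symb \<Rightarrow>\<^sub>0 int) set set" where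
  "BC'_subgroup G n = generate (SC G n) (proj_SC G n ` (rel_C G n \<union> rel_V G n \<union> rel_B2' G n))"

definition BC :: "('a, 'b) monoid_scheme \<Rightarrow> nat \<Rightarrow> ('a symb \<Rightarrow>\<^sub>0 int) set set monoid" where
  "BC G n = SC G n Mod BC_subgroup G n"

definition BC' :: "('a, 'b) monoid_scheme \<Rightarrow> nat \<Rightarrow> ('a symb \<Rightarrow>\<^sub>0 int) set set monoid" where
  "BC' G n = SC G n Mod BC'_subgroup G n"

definition proj_BC ::
  "('a, 'b) monoid_scheme \<Rightarrow> nat \<Rightarrow> ('a symb \<Rightarrow>\<^sub>0 int) set \<Rightarrow> ('a symb \<Rightarrow>\<^sub>0 int) set set" where
  "proj_BC G n X = BC_subgroup G n #>\<^bsub>SC G n\<^esub> X"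

definition proj_BC' ::
  "('a, 'b) monoid_scheme \<Rightarrow> nat \<Rightarrow> ('a symb \<Rightarrow>\<^sub>0 int) set \<Rightarrow> ('a symb \<Rightarrow>\<^sub>0 int) set set" where
  "proj_BC' G n X = BC'_subgroup G n #>\<^bsub>SC G n\<^esub> X"


section \<open>The maps\<close>

text \<open>
  Moebius function of a family \<open>P\<close> of sets ordered by inclusion. The guard
  \<open>finite B\<close> only serves termination.
\<close>

function moebius :: "'a set set \<Rightarrow> 'a set \<Rightarrow> 'a set \<Rightarrow> int" where
  "moebius P A B =
    (if A = B then 1
     else if A \<subset> B \<and> finite B then - (\<Sum>C\<in>{C \<in> P. A \<subseteq> C \<and> C \<subset> B}. moebius P A C)
     else 0)"
  by auto
termination
  by (relation "measure (\<lambda>(P, A, B). card B)") (auto intro: psubset_card_mono)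

declare moebius.simps [simp del]

definition Psi_free ::
  "('a, 'b) monoid_scheme \<Rightarrow> ('a symb \<Rightarrow>\<^sub>0 int) \<Rightarrow> 'a symb \<Rightarrow>\<^sub>0 int" where
  "Psi_free G = frag_extend (\<lambda>(H, Y, \<beta>).
     \<Sum>H'\<in>{H'. subgroup H' (G\<lparr>carrier := H\<rparr>)}. symb G H' Y (restrict_chars \<beta> H'))"

definition Phi_free ::
  "('a, 'b) monoid_scheme \<Rightarrow> ('a symb \<Rightarrow>\<^sub>0 int) \<Rightarrow> 'a symb \<Rightarrow>\<^sub>0 int" where
  "Phi_free G = frag_extend (\<lambda>(H, Y, \<beta>).
     \<Sum>H'\<in>{H'. subgroup H' (G\<lparr>carrier := H\<rparr>)}.
       frag_cmul (moebius (abelian_subgroups G) H' H) (symb G H' Y (restrict_chars \<beta> H')))"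

text \<open>
  \<open>Psi_free\<close> and \<open>Phi_free\<close> are compatible with reordering; the maps
  induced on the symbols group send a class to the common class of the images of its
  representatives.
\<close>

definition Psi_SC ::
  "('a, 'b) monoid_scheme \<Rightarrow> nat \<Rightarrow> ('a symb \<Rightarrow>\<^sub>0 int) set \<Rightarrow> ('a symb \<Rightarrow>\<^sub>0 int) set" where
  "Psi_SC G n X = the_elem ((\<lambda>x. proj_SC G n (Psi_free G x)) ` X)"

definition Phi_SC ::
  "('a, 'b) monoid_scheme \<Rightarrow> nat \<Rightarrow> ('a symb \<Rightarrow>\<^sub>0 int) set \<Rightarrow> ('a symb \<Rightarrow>\<^sub>0 int) set" where
  "Phi_SC G n X = the_elem ((\<lambda>x. proj_SC G n (Phi_free G x)) ` X)"

end

theory Submission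
  imports Defs "HOL-Algebra.Multiplicative_Group"
begin

text \<open>
  On symbols, \<open>\<Psi>\<close> is unitriangular with respect to inclusion of subgroups
  and the recursion defining the Moebius function gives \<open>\<Phi> \<circ> \<Psi> = id\<close>, so
  \<open>\<Psi>\<close> is bijective with inverse \<open>\<Phi>\<close>, already on the free group.
  The relation (B2) always reads
  \<open>(H,Y,\<beta>) = (H,Y,\<beta>\<^sub>1) + (H,Y,\<beta>\<^sub>2) + (H',Y,\<beta>|H')\<close> with
  \<open>H' = ker (b\<^sub>1 - b\<^sub>2)\<close>, because the last symbol is zero in the first case.
  The subgroups of \<open>H'\<close> are exactly those on which \<open>b\<^sub>1 = b\<^sub>2\<close>, so
  \<open>\<Psi>\<close> turns this relator into the sum of the restrictions of the corresponding (B2') relator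
  to the subgroups of \<open>H\<close> not contained in \<open>H'\<close>. Each of these is zero or, up to
  sign, a (B2') or (V) relator. So \<open>\<Psi>\<close> is also unitriangular from the relators of
  \<open>BC\<close> to those of \<open>BC'\<close>; hence it maps the subgroup spanned by the former onto the
  one spanned by the latter, and \<open>\<Phi>\<close> descends without further computation.
\<close>


section \<open>Characters\<close>

text \<open>The part that is not formal is that a restricted list must still generate the dual of
  the smaller group, so that every term of Psi and Phi is a symbol or zero. This amounts to
  extending characters from subgroups, which rests on the existence of roots in the complex numbers.
  (V) enters the comparison of the two blow-up relations because restriction can make exactly one of
  \<open>b1\<close>, \<open>b2\<close> trivial while all other entries stay nontrivial: two of the
  three symbols of the (B2') relator then vanish and the third has both c and -c among its entries.
  Treating Phi on relators directly would mean handling Moebius sums of relators. Pairing the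
  relators of the two sides, indexed by a subgroup, replaces this by a well-founded induction that
  yields an equality of spans instead of an inclusion; a left inverse of Psi then respects the spans
  automatically. The quotient is formed in two stages, so the argument is run once for (O) alone, to
  descend to the symbols group, and once for all relations together.\<close>

lemma char_group_carrier_iff:
  "b \<in> carrier (char_group K) \<longleftrightarrow> b \<in> extensional (carrier K) \<and> (\<forall>x\<in>carrier K. b x \<noteq> 0) \<and>
     (\<forall>x\<in>carrier K. \<forall>y\<in>carrier K. b (x \<otimes>\<^bsub>K\<^esub> y) = b x * b y)"
  by (auto simp: char_group_def complex_units_def hom_def)

lemma char_group_mult: "b \<otimes>\<^bsub>char_group K\<^esub> c = (\<lambda>x\<in>carrier K. b x * c x)"
  by (simp add: char_group_def)

lemma char_group_one: "\<one>\<^bsub>char_group K\<^esub> = (\<lambda>x\<in>carrier K. 1)"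
  by (simp add: char_group_def)

lemma comm_group_char_group:
  assumes "group K"
  shows "comm_group (char_group K)"
proof -
  interpret K: group K by fact
  show ?thesis
  proof (rule comm_groupI)
    fix b assume b: "b \<in> carrier (char_group K)"
    show "\<exists>c\<in>carrier (char_group K). c \<otimes>\<^bsub>char_group K\<^esub> b = \<one>\<^bsub>char_group K\<^esub>"
      using b by (intro bexI[of _ "\<lambda>x\<in>carrier K. inverse (b x)"])
        (auto simp: char_group_carrier_iff char_group_mult char_group_one)
    show "\<one>\<^bsub>char_group K\<^esub> \<otimes>\<^bsub>char_group K\<^esub> b = b"
      using b by (auto simp: char_group_carrier_iff char_group_mult char_group_one extensional_def)
  qed (auto simp: char_group_carrier_iff char_group_mult char_group_one)
qed

lemma char_group_inv:
  assumes "group K" and b: "b \<in> carrier (char_group K)"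
  shows "inv\<^bsub>char_group K\<^esub> b = (\<lambda>x\<in>carrier K. inverse (b x))"
proof -
  interpret K: group K by fact
  interpret D: comm_group "char_group K" by (rule comm_group_char_group) fact
  show ?thesis
    using b by (intro D.inv_equality)
      (auto simp: char_group_carrier_iff char_group_mult char_group_one)
qed

lemma char_minus_eq:
  assumes "group G" "subgroup H G" "c \<in> carrier (dual G H)"
  shows "char_minus G H b c = (\<lambda>x\<in>H. b x / c x)"
proof -
  have "group (G\<lparr>carrier := H\<rparr>)"
    using assms by (simp add: subgroup.subgroup_is_group)
  then show ?thesis
    using assms by (auto simp: char_minus_def char_group_inv char_group_mult divide_inverse)
qed

section \<open>Extension of characters from subgroups of a finite abelian group\<close>

lemma complex_root_exists:
  assumes "0 < m"
  shows "\<exists>z::complex. z ^ m = w"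
proof
  show "rcis (root m (cmod w)) (Arg w / m) ^ m = w"
    using assms by (simp add: DeMoivre2 rcis_cmod_Arg)
qed

text \<open>The extension lives on the product of L with the cyclic group of x and is given by c(l
  x^i) = b(l) z^i, where z is a root of a value of b. Everything reduces to showing that this does
  not depend on the representation l x^i.\<close>

lemma (in comm_group) character_extend_insert:
  assumes fin: "finite (carrier G)" and L: "subgroup L G"
    and b: "b \<in> carrier (dual G L)" and x: "x \<in> carrier G"
  obtains M c where "subgroup M G" "L \<subseteq> M" "x \<in> M" "c \<in> carrier (dual G M)" "restrict c L = b"
proof -
  interpret L: subgroup L G by fact
  define M where "M = L <#> generate G {x}"
  have M: "subgroup M G"
    unfolding M_def using x by (intro mult_subgroups L generate_is_subgroup) auto
  \<comment> \<open>In a finite group the cyclic subgroup of x consists of the powers with natural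
    exponents, so negative exponents never have to be represented.\<close>
  have M_eq: "M = {l \<otimes> x [^] i | l i. l \<in> L \<and> i \<in> (UNIV :: nat set)}"
    unfolding M_def set_mult_def generate_pow_on_finite_carrier[OF fin x] by auto
  \<comment> \<open>\<open>m\<close> is the order of x modulo L; \<open>ord x\<close> witnesses that
    some positive power of x lies in L.\<close>
  define m where "m = (LEAST m::nat. 0 < m \<and> x [^] m \<in> L)"
  have "0 < ord x \<and> x [^] ord x \<in> L"
    using fin x ord_ge_1[of x] by (simp add: pow_ord_eq_1)
  then have m: "0 < m" "x [^] m \<in> L"
    unfolding m_def using LeastI[of "\<lambda>m. 0 < m \<and> x [^] m \<in> L"] by blast+
  have m_least: "m \<le> k" if "0 < k" "x [^] k \<in> L" for k
    unfolding m_def using that by (intro Least_le) auto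
  have m_pow: "x [^] (m * q) \<in> L" for q
    using m(2) x by (induction q) (auto simp: nat_pow_mult[symmetric])
  have m_dvd: "m dvd k" if "x [^] k \<in> L" for k
  proof (rule ccontr)
    assume "\<not> m dvd k"
    then have pos: "0 < k mod m"
      by (auto simp: dvd_eq_mod_eq_0)
    have "x [^] k = x [^] (m * (k div m)) \<otimes> x [^] (k mod m)"
      using x by (simp add: nat_pow_mult)
    then have "x [^] (k mod m) = inv (x [^] (m * (k div m))) \<otimes> x [^] k"
      using x by (simp add: m_assoc[symmetric])
    then have "x [^] (k mod m) \<in> L"
      using that m_pow by simp
    then show False
      using m_least[OF pos] mod_less_divisor[OF m(1), of k] by simp
  qed
  have b_mult: "b (u \<otimes> v) = b u * b v" if "u \<in> L" "v \<in> L" for u v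
    using b that by (simp add: char_group_carrier_iff)
  have b_nz: "b u \<noteq> 0" if "u \<in> L" for u
    using b that by (simp add: char_group_carrier_iff)
  have b_one: "b \<one> = 1"
    using b_mult[of \<one> \<one>] b_nz[of \<one>] by simp
  \<comment> \<open>The future value z of c at x must satisfy z^m = b(x^m). Since \<open>m\<close>
    divides every exponent k with x^k in L, this is the only constraint on z.\<close>
  obtain z where z: "z ^ m = b (x [^] m)"
    using complex_root_exists[OF m(1)] by blast
  have z_nz: "z \<noteq> 0"
    using z b_nz[OF m(2)] m(1) by (metis zero_power)
  have z_pow: "b (x [^] (m * q)) = z ^ (m * q)" for q
  proof (induction q)
    case (Suc q)
    have "b (x [^] (m * Suc q)) = b (x [^] m) * b (x [^] (m * q))"
      using x m(2) m_pow by (simp add: nat_pow_mult[symmetric] b_mult)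
    then show ?case
      by (simp only: Suc z[symmetric] power_add[symmetric] mult_Suc_right)
  qed (simp add: b_one)
  \<comment> \<open>Two representations differ by x^(j - i), which therefore lies in L. The
    assumption \<open>i \<le> j\<close> keeps the exponent natural; the other case follows by
    exchanging the representations.\<close>
  have wd: "b l * z ^ i = b l' * z ^ j"
    if "l \<in> L" "l' \<in> L" "l \<otimes> x [^] i = l' \<otimes> x [^] j" "i \<le> j" for l l' i j
  proof -
    have "l \<otimes> x [^] i = l' \<otimes> x [^] (j - i) \<otimes> x [^] i"
      using that x by (simp add: m_assoc nat_pow_mult)
    then have l: "l = l' \<otimes> x [^] (j - i)"
      using that x by simp
    then have "x [^] (j - i) = inv l' \<otimes> l"
      using that x by (simp add: m_assoc[symmetric])
    then have xL: "x [^] (j - i) \<in> L"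
      using that by simp
    then obtain q where "j - i = m * q"
      using m_dvd by blast
    then have "b l = b l' * z ^ (j - i)"
      using l xL that(2) by (simp add: b_mult z_pow)
    then have "b l * z ^ i = b l' * (z ^ (j - i) * z ^ i)"
      by (simp only: mult.assoc)
    then show ?thesis
      using \<open>i \<le> j\<close> by (simp only: power_add[symmetric] le_add_diff_inverse2)
  qed
  \<comment> \<open>The value is selected among those given by all representations of y; by
    \<open>wd\<close> they agree.\<close>
  define c where "c = (\<lambda>y\<in>M. SOME w. \<exists>l\<in>L. \<exists>i::nat. y = l \<otimes> x [^] i \<and> w = b l * z ^ i)"
  have c: "c (l \<otimes> x [^] i) = b l * z ^ i" if "l \<in> L" for l i
  proof -
    have "l \<otimes> x [^] i \<in> M"
      using that M_eq by auto
    moreover have "(SOME w. \<exists>l'\<in>L. \<exists>j::nat. l \<otimes> x [^] i = l' \<otimes> x [^] j \<and> w = b l' * z ^ j) = b l * z ^ i"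
    proof (rule some_equality)
      show "\<exists>l'\<in>L. \<exists>j. l \<otimes> x [^] i = l' \<otimes> x [^] j \<and> b l * z ^ i = b l' * z ^ j"
        using that by blast
      show "w = b l * z ^ i"
        if "\<exists>l'\<in>L. \<exists>j. l \<otimes> x [^] i = l' \<otimes> x [^] j \<and> w = b l' * z ^ j" for w
        using that wd \<open>l \<in> L\<close> nat_le_linear by metis
    qed
    ultimately show ?thesis
      by (simp add: c_def)
  qed
  show ?thesis
  proof
    show "L \<subseteq> M"
    proof
      fix l assume "l \<in> L"
      moreover have "l = l \<otimes> x [^] (0::nat)"
        using \<open>l \<in> L\<close> by simp
      ultimately show "l \<in> M"
        unfolding M_eq by blast
    qed
    show "x \<in> M"
    proof -
      have "x = \<one> \<otimes> x [^] (1::nat)"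
        using x by simp
      then show ?thesis
        unfolding M_eq using L.one_closed by blast
    qed
    show "c \<in> carrier (dual G M)"
      unfolding char_group_carrier_iff
    proof (simp, intro conjI ballI)
      show "c \<in> extensional M"
        by (simp add: c_def)
      show "c y \<noteq> 0" if "y \<in> M" for y
        using that z_nz b_nz by (auto simp: M_eq c)
      fix y y' assume "y \<in> M" "y' \<in> M"
      then obtain l l' and i j :: nat
        where y: "l \<in> L" "y = l \<otimes> x [^] i" "l' \<in> L" "y' = l' \<otimes> x [^] j"
        by (auto simp: M_eq)
      have "y \<otimes> y' = (l \<otimes> l') \<otimes> x [^] (i + j)"
        using y x by (simp add: nat_pow_mult[symmetric] m_ac)
      then have "c (y \<otimes> y') = b (l \<otimes> l') * z ^ (i + j)"
        using y by (simp only: c L.m_closed)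
      then show "c (y \<otimes> y') = c y * c y'"
        using y by (simp add: c b_mult power_add)
    qed
    show "restrict c L = b"
    proof (rule extensionalityI)
      show "b \<in> extensional L"
        using b by (simp add: char_group_carrier_iff)
      show "restrict c L l = b l" if "l \<in> L" for l
        using that c[of l 0] by simp
    qed auto
  qed (fact M)
qed

text \<open>As long as L is proper, an element outside it can be adjoined, and this strictly lowers
  the difference of the cardinalities.\<close>

lemma (in comm_group) character_extend:
  assumes fin: "finite (carrier G)" and L: "subgroup L G" and b: "b \<in> carrier (dual G L)"
  shows "\<exists>c\<in>carrier (char_group G). restrict c L = b"
  using L b
proof (induction "card (carrier G) - card L" arbitrary: L b rule: less_induct)
  case less
  have sub: "L \<subseteq> carrier G"
    using less.prems subgroup.subset by blast
  show ?case
  proof (cases "L = carrier G")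
    case True
    with less.prems have "b \<in> carrier (char_group G)"
      by (simp add: char_group_carrier_iff)
    moreover have "restrict b L = b"
      using less.prems by (simp add: char_group_carrier_iff extensional_restrict)
    ultimately show ?thesis
      by blast
  next
    case False
    then obtain x where x: "x \<in> carrier G" "x \<notin> L"
      using sub by blast
    obtain M c where M: "subgroup M G" "L \<subseteq> M" "x \<in> M" "c \<in> carrier (dual G M)" "restrict c L = b"
      using character_extend_insert[OF fin less.prems x(1)] .
    have MG: "M \<subseteq> carrier G"
      using M subgroup.subset by blast
    have "card L < card M"
      using M x MG fin by (intro psubset_card_mono) (auto intro: finite_subset)
    moreover have "card M \<le> card (carrier G)"
      using MG fin by (simp add: card_mono)
    ultimately obtain d where d: "d \<in> carrier (char_group G)" "restrict d M = c"
      using less.hyps[of M c] M by force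
    then have "restrict d L = b"
      using M by (metis inf.absorb2 restrict_restrict)
    then show ?thesis
      using d by blast
  qed
qed


section \<open>Restriction of symbols\<close>

lemma one_dual: "\<one>\<^bsub>dual G H\<^esub> = (\<lambda>x\<in>H. 1)"
  by (simp add: char_group_one)

lemma mult_dual: "b \<otimes>\<^bsub>dual G H\<^esub> c = (\<lambda>x\<in>H. b x * c x)"
  by (simp add: char_group_mult)

lemma dual_carrier_iff:
  "b \<in> carrier (dual G H) \<longleftrightarrow> b \<in> extensional H \<and> (\<forall>x\<in>H. b x \<noteq> 0) \<and>
     (\<forall>x\<in>H. \<forall>y\<in>H. b (x \<otimes>\<^bsub>G\<^esub> y) = b x * b y)"
  by (simp add: char_group_carrier_iff)

lemma restrict_one_dual: "K \<subseteq> H \<Longrightarrow> restrict \<one>\<^bsub>dual G H\<^esub> K = \<one>\<^bsub>dual G K\<^esub>"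
  by (simp add: one_dual Int_absorb1)

lemma set_restrict_chars [simp]: "set (restrict_chars \<beta> K) = (\<lambda>b. restrict b K) ` set \<beta>"
  by (simp add: restrict_chars_def)

lemma length_restrict_chars [simp]: "length (restrict_chars \<beta> K) = length \<beta>"
  by (simp add: restrict_chars_def)

lemma restrict_chars_Cons [simp]:
  "restrict_chars (b # \<beta>) K = restrict b K # restrict_chars \<beta> K"
  by (simp add: restrict_chars_def)

lemma restrict_chars_restrict_chars:
  "K \<subseteq> H \<Longrightarrow> restrict_chars (restrict_chars \<beta> H) K = restrict_chars \<beta> K"
  by (simp add: restrict_chars_def Int_absorb1)

lemma symb_eq_0: "\<one>\<^bsub>dual G H\<^esub> \<in> set \<beta> \<Longrightarrow> symb G H Y \<beta> = 0"
  by (simp add: symb_def)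

lemma symb_restrict_eq_0:
  "K \<subseteq> H \<Longrightarrow> \<one>\<^bsub>dual G H\<^esub> \<in> set \<beta> \<Longrightarrow> symb G K Y (restrict_chars \<beta> K) = 0"
  by (metis image_eqI restrict_one_dual set_restrict_chars symb_eq_0)

text \<open>The formula for Psi survives the zero convention: a trivial character stays trivial on
  every subgroup, so all summands vanish with the symbol. It can thus be applied to
  \<open>symb\<close> terms without checking whether they denote symbols.\<close>

lemma Psi_free_symb:
  "Psi_free G (symb G H Y \<beta>) =
     (\<Sum>K | subgroup K (G\<lparr>carrier := H\<rparr>). symb G K Y (restrict_chars \<beta> K))"
proof (cases "\<one>\<^bsub>dual G H\<^esub> \<in> set \<beta>")
  case True
  then have "symb G K Y (restrict_chars \<beta> K) = 0" if "subgroup K (G\<lparr>carrier := H\<rparr>)" for K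
    using subgroup.subset[OF that] by (simp add: symb_restrict_eq_0)
  with True show ?thesis
    by (simp add: Psi_free_def symb_eq_0)
qed (simp add: Psi_free_def symb_def)

lemma Phi_free_symb:
  "Phi_free G (symb G H Y \<beta>) =
     (\<Sum>K | subgroup K (G\<lparr>carrier := H\<rparr>).
        frag_cmul (moebius (abelian_subgroups G) K H) (symb G K Y (restrict_chars \<beta> K)))"
proof (cases "\<one>\<^bsub>dual G H\<^esub> \<in> set \<beta>")
  case True
  then have "symb G K Y (restrict_chars \<beta> K) = 0" if "subgroup K (G\<lparr>carrier := H\<rparr>)" for K
    using subgroup.subset[OF that] by (simp add: symb_restrict_eq_0)
  with True show ?thesis
    by (simp add: Phi_free_def symb_eq_0)
qed (simp add: Phi_free_def symb_def)

lemma frag_cmul_sum_left: "frag_cmul (sum f A) x = (\<Sum>a\<in>A. frag_cmul (f a) x)"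
  by (induction A rule: infinite_finite_induct) (simp_all add: frag_cmul_distrib)

lemma symb_in_carrier: "(H, Y, \<beta>) \<in> symbols G n \<Longrightarrow> symb G H Y \<beta> \<in> carrier (free_symbols G n)"
  by (simp add: symb_def)

lemma symb_symbol: "(H, Y, \<beta>) \<in> symbols G n \<Longrightarrow> symb G H Y \<beta> = frag_of (H, Y, \<beta>)"
  by (auto simp: symb_def symbols_def)

section \<open>Subgroups, duals and restricted symbols in a finite group\<close>

locale finite_group = group G for G (structure) +
  assumes finite_carrier: "finite (carrier G)"
begin

lemma subgroup_of_subgroup_iff:
  assumes "subgroup H G"
  shows "subgroup K (G\<lparr>carrier := H\<rparr>) \<longleftrightarrow> subgroup K G \<and> K \<subseteq> H"
proof
  assume K: "subgroup K (G\<lparr>carrier := H\<rparr>)"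
  then show "subgroup K G \<and> K \<subseteq> H"
    using incl_subgroup[OF assms K] subgroup.subset[OF K] by simp
qed (use assms subgroup_incl in blast)

lemma finite_subgroup: "subgroup H G \<Longrightarrow> finite H"
  using finite_carrier finite_subset subgroup.subset by blast

lemma finite_subgroups: "finite {K. subgroup K G \<and> P K}"
  by (rule finite_subset[of _ "Pow (carrier G)"]) (auto simp: finite_carrier dest: subgroup.subset)

lemma comm_group_dual: "subgroup H G \<Longrightarrow> comm_group (dual G H)"
  by (simp add: comm_group_char_group subgroup_imp_group)

lemma abelian_subgroups_mono:
  assumes "H \<in> abelian_subgroups G" "subgroup K G" "K \<subseteq> H"
  shows "K \<in> abelian_subgroups G"
proof -
  interpret H: comm_group "G\<lparr>carrier := H\<rparr>"
    using assms(1) by (simp add: abelian_subgroups_def)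
  have "comm_group (G\<lparr>carrier := K\<rparr>)"
    using assms subgroup_imp_group[OF assms(2)] H.m_comm
    by (intro group.group_comm_groupI) auto
  then show ?thesis
    using assms by (simp add: abelian_subgroups_def)
qed

lemma restrict_dual:
  "K \<subseteq> H \<Longrightarrow> subgroup K G \<Longrightarrow> b \<in> carrier (dual G H) \<Longrightarrow> restrict b K \<in> carrier (dual G K)"
  by (auto simp: dual_carrier_iff subset_iff subgroup.m_closed)

lemma char_minus_closed:
  "subgroup H G \<Longrightarrow> b \<in> carrier (dual G H) \<Longrightarrow> c \<in> carrier (dual G H) \<Longrightarrow>
   char_minus G H b c \<in> carrier (dual G H)"
  unfolding char_minus_def
  by (intro monoid.m_closed group.inv_closed group.is_monoid comm_group.axioms(2) comm_group_dual)

lemma char_minus_eq_one_iff: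
  "subgroup H G \<Longrightarrow> b \<in> carrier (dual G H) \<Longrightarrow> c \<in> carrier (dual G H) \<Longrightarrow>
   char_minus G H b c = \<one>\<^bsub>dual G H\<^esub> \<longleftrightarrow> b = c"
  unfolding char_minus_def
proof -
  assume "subgroup H G" and bc: "b \<in> carrier (dual G H)" "c \<in> carrier (dual G H)"
  then interpret D: comm_group "dual G H"
    using comm_group_dual by blast
  show "b \<otimes>\<^bsub>dual G H\<^esub> inv\<^bsub>dual G H\<^esub> c = \<one>\<^bsub>dual G H\<^esub> \<longleftrightarrow> b = c"
    using bc by (metis D.inv_closed D.inv_equality D.inv_inv D.r_inv)
qed

lemma restrict_char_minus:
  assumes "subgroup H G" "subgroup K G" "K \<subseteq> H" "c \<in> carrier (dual G H)"
  shows "restrict (char_minus G H b c) K = char_minus G K (restrict b K) (restrict c K)"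
  using assms restrict_dual[of K H c]
  by (subst (1 2) char_minus_eq) (auto simp: is_group fun_eq_iff restrict_def)

lemma restrict_hom:
  assumes "subgroup H G" "subgroup K G" "K \<subseteq> H"
  shows "group_hom (dual G H) (dual G K) (\<lambda>b. restrict b K)"
proof -
  have "restrict (b \<otimes>\<^bsub>dual G H\<^esub> c) K = restrict b K \<otimes>\<^bsub>dual G K\<^esub> restrict c K" for b c
    using assms by (auto simp: mult_dual fun_eq_iff restrict_def)
  then have "(\<lambda>b. restrict b K) \<in> hom (dual G H) (dual G K)"
    using assms by (auto simp: hom_def restrict_dual)
  then show ?thesis
    using assms comm_group_dual by (simp add: group_hom_def group_hom_axioms_def comm_group.axioms)
qed

text \<open>Surjectivity is extension of characters inside the finite abelian group H. It carries
  generators of the dual of H to generators of the dual of K.\<close>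

lemma restrict_dual_surj:
  assumes "H \<in> abelian_subgroups G" "subgroup K G" "K \<subseteq> H"
  shows "(\<lambda>b. restrict b K) ` carrier (dual G H) = carrier (dual G K)"
proof
  show "(\<lambda>b. restrict b K) ` carrier (dual G H) \<subseteq> carrier (dual G K)"
    using assms restrict_dual by blast
  interpret H: comm_group "G\<lparr>carrier := H\<rparr>"
    using assms(1) by (simp add: abelian_subgroups_def)
  have "subgroup H G"
    using assms(1) by (simp add: abelian_subgroups_def)
  then have "finite H" "subgroup K (G\<lparr>carrier := H\<rparr>)"
    using assms by (simp_all add: finite_subgroup subgroup_of_subgroup_iff)
  then show "carrier (dual G K) \<subseteq> (\<lambda>b. restrict b K) ` carrier (dual G H)"
    using H.character_extend[of K] by fastforce
qed

lemma centralizer_antimono: "K \<subseteq> H \<Longrightarrow> centralizer G H \<subseteq> centralizer G K"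
  by (auto simp: centralizer_def)

lemma symbolsD:
  assumes "(H, Y, \<beta>) \<in> symbols G n"
  shows "H \<in> abelian_subgroups G" "subgroup H G" "subgroup Y G" "set \<beta> \<subseteq> carrier (dual G H)"
    "\<one>\<^bsub>dual G H\<^esub> \<notin> set \<beta>" "generate (dual G H) (set \<beta>) = carrier (dual G H)"
  using assms by (auto simp: symbols_def abelian_subgroups_def)

text \<open>Generation passes along the surjective restriction map, and the centralizer grows when
  the subgroup shrinks, so the same Y remains admissible.\<close>

lemma restrict_symbol:
  assumes s: "(H, Y, \<beta>) \<in> symbols G n" and K: "subgroup K G" "K \<subseteq> H"
    and nz: "\<one>\<^bsub>dual G K\<^esub> \<notin> set (restrict_chars \<beta> K)"
  shows "(K, Y, restrict_chars \<beta> K) \<in> symbols G n"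
proof -
  interpret r: group_hom "dual G H" "dual G K" "\<lambda>b. restrict b K"
    using restrict_hom[OF symbolsD(2)[OF s] K] .
  have "generate (dual G K) (set (restrict_chars \<beta> K)) = carrier (dual G K)"
    using r.generate_img[OF symbolsD(4)[OF s]] symbolsD(6)[OF s] restrict_dual_surj[OF symbolsD(1)[OF s] K]
    by simp
  moreover have "K \<in> abelian_subgroups G"
    using abelian_subgroups_mono[OF symbolsD(1)[OF s] K] .
  moreover have "set (restrict_chars \<beta> K) \<subseteq> carrier (dual G K)"
    using symbolsD(4)[OF s] restrict_dual K by auto
  ultimately show ?thesis
    using s K nz centralizer_antimono[OF K(2)] unfolding symbols_def
    by (auto simp del: set_restrict_chars)
qed

lemma symb_restrict_cases:
  assumes s: "(H, Y, \<beta>) \<in> symbols G n" and K: "subgroup K G" "K \<subseteq> H"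
  obtains "\<one>\<^bsub>dual G K\<^esub> \<in> set (restrict_chars \<beta> K)" "symb G K Y (restrict_chars \<beta> K) = 0"
  | "(K, Y, restrict_chars \<beta> K) \<in> symbols G n"
  using restrict_symbol[OF assms] symb_eq_0 by blast

lemma symb_restrict_in_carrier:
  assumes "(H, Y, \<beta>) \<in> symbols G n" "subgroup K G" "K \<subseteq> H"
  shows "symb G K Y (restrict_chars \<beta> K) \<in> carrier (free_symbols G n)"
  by (rule symb_restrict_cases[OF assms]) (simp_all add: symb_def)

lemma restrict_chars_self: "set \<beta> \<subseteq> carrier (dual G H) \<Longrightarrow> restrict_chars \<beta> H = \<beta>"
  unfolding restrict_chars_def by (intro map_idI) (auto simp: dual_carrier_iff extensional_restrict)

section \<open>Moebius inversion\<close>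

lemma sum_moebius_eq_0:
  assumes H: "H \<in> abelian_subgroups G" and L: "L \<subset> H"
  shows "(\<Sum>K | subgroup K G \<and> L \<subseteq> K \<and> K \<subseteq> H. moebius (abelian_subgroups G) L K) = 0"
proof -
  have sub: "subgroup H G"
    using H by (simp add: abelian_subgroups_def)
  \<comment> \<open>Subgroups of the abelian group H are abelian, so the interval of all subgroups
    between L and H is the interval in the Moebius poset, with its top element H split off.\<close>
  have eq: "{K. subgroup K G \<and> L \<subseteq> K \<and> K \<subseteq> H} = insert H {K \<in> abelian_subgroups G. L \<subseteq> K \<and> K \<subset> H}"
    using H L sub abelian_subgroups_mono[OF H] by (auto simp: abelian_subgroups_def)
  have "finite {K \<in> abelian_subgroups G. L \<subseteq> K \<and> K \<subset> H}"
    by (rule finite_subset[OF _ finite_subgroups[of "\<lambda>_. True"]]) (auto simp: abelian_subgroups_def)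
  then show ?thesis
    using L finite_subgroup[OF sub]
    by (simp add: eq moebius.simps[of "abelian_subgroups G" L H] psubset_imp_subset less_imp_neq)
qed

text \<open>Restricting twice is restricting once, so the coefficient of the symbol over L is the
  sum of mu(L,K) over all K between L and H. The recursion of \<open>moebius\<close> runs over its
  upper argument, which is exactly this sum, so only L = H survives.\<close>

lemma Phi_Psi_frag_of:
  assumes s: "(H, Y, \<beta>) \<in> symbols G n"
  shows "Phi_free G (Psi_free G (frag_of (H, Y, \<beta>))) = frag_of (H, Y, \<beta>)"
proof -
  let ?\<mu> = "moebius (abelian_subgroups G)"
  define S where "S K = symb G K Y (restrict_chars \<beta> K)" for K
  have H: "H \<in> abelian_subgroups G" "subgroup H G"
    using symbolsD[OF s] by auto
  have sums: "Phi_free G (sum f I) = (\<Sum>i\<in>I. Phi_free G (f i))" if "finite I" for f and I :: "'a set set"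
    using that by (simp add: Phi_free_def frag_extend_sum)
  have Phi_S: "Phi_free G (S K) = (\<Sum>L | subgroup L G \<and> L \<subseteq> K. frag_cmul (?\<mu> L K) (S L))"
    if "subgroup K G" for K
    using that by (auto simp: S_def Phi_free_symb subgroup_of_subgroup_iff restrict_chars_restrict_chars
        intro!: sum.cong)
  have "Phi_free G (Psi_free G (frag_of (H, Y, \<beta>))) =
      Phi_free G (\<Sum>K | subgroup K G \<and> K \<subseteq> H. S K)"
    using Psi_free_symb[of G H Y \<beta>]
    by (simp add: symb_symbol[OF s] S_def subgroup_of_subgroup_iff[OF H(2)])
  also have "\<dots> = (\<Sum>K | subgroup K G \<and> K \<subseteq> H. \<Sum>L | subgroup L G \<and> L \<subseteq> K. frag_cmul (?\<mu> L K) (S L))"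
    by (simp add: sums finite_subgroups Phi_S)
  also have "\<dots> = (\<Sum>L | subgroup L G \<and> L \<subseteq> H. \<Sum>K | subgroup K G \<and> L \<subseteq> K \<and> K \<subseteq> H.
      frag_cmul (?\<mu> L K) (S L))"
  proof -
    have "(\<Sum>K | subgroup K G \<and> K \<subseteq> H. \<Sum>L | subgroup L G \<and> L \<subseteq> K. frag_cmul (?\<mu> L K) (S L)) =
      (\<Sum>K | subgroup K G \<and> K \<subseteq> H. \<Sum>L | L \<in> {L. subgroup L G \<and> L \<subseteq> H} \<and> L \<subseteq> K. frag_cmul (?\<mu> L K) (S L))"
      by (intro sum.cong) auto
    also have "\<dots> = (\<Sum>L | subgroup L G \<and> L \<subseteq> H. \<Sum>K | K \<in> {K. subgroup K G \<and> K \<subseteq> H} \<and> L \<subseteq> K.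
      frag_cmul (?\<mu> L K) (S L))"
      by (rule sum.swap_restrict) (rule finite_subgroups)+
    also have "\<dots> = (\<Sum>L | subgroup L G \<and> L \<subseteq> H. \<Sum>K | subgroup K G \<and> L \<subseteq> K \<and> K \<subseteq> H.
      frag_cmul (?\<mu> L K) (S L))"
      by (intro sum.cong) auto
    finally show ?thesis .
  qed
  also have "\<dots> = (\<Sum>L | subgroup L G \<and> L \<subseteq> H.
      frag_cmul (\<Sum>K | subgroup K G \<and> L \<subseteq> K \<and> K \<subseteq> H. ?\<mu> L K) (S L))"
    by (simp add: frag_cmul_sum_left finite_subgroups)
  also have "\<dots> = (\<Sum>L | subgroup L G \<and> L \<subseteq> H. if L = H then S H else 0)"
  proof (intro sum.cong refl)
    fix L assume L: "L \<in> {L. subgroup L G \<and> L \<subseteq> H}"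
    have "{K. subgroup K G \<and> H \<subseteq> K \<and> K \<subseteq> H} = {H}"
      using H by auto
    then show "frag_cmul (\<Sum>K | subgroup K G \<and> L \<subseteq> K \<and> K \<subseteq> H. ?\<mu> L K) (S L) = (if L = H then S H else 0)"
      using L sum_moebius_eq_0[OF H(1), of L] by (auto simp: moebius.simps[of _ H H])
  qed
  also have "\<dots> = S H"
    using H(2) by (simp add: finite_subgroups)
  also have "\<dots> = frag_of (H, Y, \<beta>)"
    using symbolsD(4)[OF s] by (simp add: S_def restrict_chars_self symb_symbol[OF s])
  finally show ?thesis .
qed

end


section \<open>Quotients and triangular endomorphisms\<close>

lemma hom_image_r_coset:
  assumes "f \<in> hom A B" "N \<subseteq> carrier A" "x \<in> carrier A"
  shows "f ` (N #>\<^bsub>A\<^esub> x) = f ` N #>\<^bsub>B\<^esub> f x"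
proof -
  have "f (n \<otimes>\<^bsub>A\<^esub> x) = f n \<otimes>\<^bsub>B\<^esub> f x" if "n \<in> N" for n
    using assms that by (auto simp: hom_def)
  then show ?thesis
    by (simp add: r_coset_def image_UN)
qed

text \<open>Elements of a factor group are cosets, so the induced map is literally the direct image.
  It is injective because f is injective on the carrier, and taking the image of N as the target
  subgroup makes it well defined and onto.\<close>

lemma image_iso_FactGroup:
  assumes A: "comm_group A" and B: "comm_group B" and f: "f \<in> iso A B" and N: "subgroup N A"
  shows "(`) f \<in> iso (A Mod N) (B Mod (f ` N))"
proof -
  interpret A: comm_group A by fact
  interpret B: comm_group B by fact
  interpret f: group_hom A B f
    using f by (unfold_locales) (simp add: iso_def)
  have NA: "N \<subseteq> carrier A"
    using N subgroup.subset by blast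
  have bij: "inj_on f (carrier A)" "f ` carrier A = carrier B"
    using f by (auto simp: iso_def bij_betw_def)
  interpret N: normal N A
    using N A.normal_iff_subgroup by blast
  interpret fN: normal "f ` N" B
    using f.subgroup_img_is_subgroup[OF N] B.normal_iff_subgroup by blast
  have img: "f ` (N #>\<^bsub>A\<^esub> x) = f ` N #>\<^bsub>B\<^esub> f x" if "x \<in> carrier A" for x
    using hom_image_r_coset[OF f.homh NA that] .
  show ?thesis
  proof (rule isoI)
    show "(`) f \<in> hom (A Mod N) (B Mod (f ` N))"
    proof (rule homI)
      fix X Y assume "X \<in> carrier (A Mod N)" "Y \<in> carrier (A Mod N)"
      then obtain x y where "x \<in> carrier A" "X = N #>\<^bsub>A\<^esub> x" "y \<in> carrier A" "Y = N #>\<^bsub>A\<^esub> y"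
        by (auto simp: carrier_FactGroup)
      then show "f ` (X \<otimes>\<^bsub>A Mod N\<^esub> Y) = f ` X \<otimes>\<^bsub>B Mod (f ` N)\<^esub> f ` Y"
        by (simp add: img N.rcos_sum fN.rcos_sum)
    qed (auto simp: carrier_FactGroup img)
    have "inj_on ((`) f) (carrier (A Mod N))"
      by (rule inj_on_subset[OF inj_on_image_Pow[OF bij(1)]])
        (auto simp: carrier_FactGroup dest: subsetD[OF A.r_coset_subset_G[OF NA]])
    moreover have "(`) f ` carrier (A Mod N) = carrier (B Mod (f ` N))"
      by (simp add: carrier_FactGroup img image_image bij(2)[symmetric])
    ultimately show "bij_betw ((`) f) (carrier (A Mod N)) (carrier (B Mod (f ` N)))"
      by (simp add: bij_betw_def)
  qed
qed

section \<open>Spans under triangular endomorphisms\<close>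

lemma (in group) generate_insert_one:
  assumes "X \<subseteq> carrier G"
  shows "generate G (insert \<one> X) = generate G X"
proof
  show "generate G (insert \<one> X) \<subseteq> generate G X"
    using assms by (intro generate_subgroup_incl generate_is_subgroup) (auto intro: generate.one generate.incl)
qed (intro mono_generate subset_insertI)

text \<open>P pairs elements of two families by an index i, and h maps r to its partner r' up to
  partners of smaller index. The image of the first span then lies in the second, and a well-founded
  induction recovers each r' from images. Obtaining an equality is what later makes the induced maps
  on quotients injective.\<close>

lemma (in group) image_generate_triangular:
  assumes h: "h \<in> hom G G" and wf: "wf R"
    and P: "\<And>i r r'. P i r r' \<Longrightarrow> r \<in> carrier G \<and> r' \<in> carrier G \<and>
      h r \<otimes> inv r' \<in> generate G {s'. \<exists>k s. (k, i) \<in> R \<and> P k s s'}"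
  shows "h ` generate G {r. \<exists>i r'. P i r r'} = generate G {r'. \<exists>i r. P i r r'}"
    (is "h ` generate G ?L = generate G ?R")
proof -
  interpret h: group_hom G G h
    using h by unfold_locales
  have LG: "?L \<subseteq> carrier G" and RG: "?R \<subseteq> carrier G"
    using P by blast+
  have hG: "h x \<in> carrier G" if "x \<in> carrier G" for x
    using that by simp
  have img: "generate G (h ` ?L) = h ` generate G ?L"
    using h.generate_img[OF LG] .
  have LG': "h ` ?L \<subseteq> carrier G"
    using LG hG by blast
  have "h r \<in> generate G ?R" if "P i r r'" for i r r'
  proof -
    have "h r \<otimes> inv r' \<in> generate G ?R"
      using P[OF that] mono_generate[of "{s'. \<exists>k s. (k, i) \<in> R \<and> P k s s'}" ?R] by blast
    moreover have "r' \<in> generate G ?R"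
      using that by (blast intro: generate.incl)
    ultimately have "h r \<otimes> inv r' \<otimes> r' \<in> generate G ?R"
      by (rule generate.eng)
    then show ?thesis
      using P[OF that] hG by (simp add: m_assoc)
  qed
  then have "generate G (h ` ?L) \<subseteq> generate G ?R"
    by (intro generate_subgroup_incl generate_is_subgroup RG) blast
  \<comment> \<open>By induction the partners of smaller index lie in the span of the images, hence
    so does the error \<open>h r \<otimes> inv r'\<close>. Its inverse times \<open>h r\<close> is
    \<open>r'\<close>.\<close>
  moreover have "P i r r' \<Longrightarrow> r' \<in> generate G (h ` ?L)" for i r r'
    using wf
  proof (induction i arbitrary: r r' rule: wf_induct_rule)
    case (less i)
    have "{s'. \<exists>k s. (k, i) \<in> R \<and> P k s s'} \<subseteq> generate G (h ` ?L)"
      using less.IH by blast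
    then have "generate G {s'. \<exists>k s. (k, i) \<in> R \<and> P k s s'} \<subseteq> generate G (h ` ?L)"
      by (intro generate_subgroup_incl generate_is_subgroup LG')
    then have "inv (h r \<otimes> inv r') \<in> generate G (h ` ?L)"
      using P[OF less.prems] by (intro generate_m_inv_closed LG') blast
    moreover have "h r \<in> generate G (h ` ?L)"
      using less.prems by (intro generate.incl) blast
    ultimately have "inv (h r \<otimes> inv r') \<otimes> h r \<in> generate G (h ` ?L)"
      by (rule generate.eng)
    then show ?case
      using P[OF less.prems] hG[of r] by (simp add: inv_mult_group m_assoc)
  qed
  then have "generate G ?R \<subseteq> generate G (h ` ?L)"
    by (intro generate_subgroup_incl generate_is_subgroup LG') blast
  ultimately show ?thesis
    using img by blast
qed

text \<open>Lets the triangular argument be applied to the basis of a free abelian group, where it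
  yields surjectivity.\<close>

lemma generate_frag_of: "generate (free_Abelian_group S) (frag_of ` S) = carrier (free_Abelian_group S)"
proof -
  let ?F = "free_Abelian_group S"
  interpret F: group ?F by simp
  have sub: "frag_of ` S \<subseteq> carrier ?F"
    by auto
  interpret g: subgroup "generate ?F (frag_of ` S)" ?F
    by (rule F.generate_is_subgroup[OF sub])
  have "x \<in> generate ?F (frag_of ` S)" if "Poly_Mapping.keys x \<subseteq> S" for x
  proof (rule free_Abelian_group_induct[OF that])
    show "0 \<in> generate ?F (frag_of ` S)"
      using g.one_closed by simp
    show "y - z \<in> generate ?F (frag_of ` S)"
      if "Poly_Mapping.keys z \<subseteq> S" "y \<in> generate ?F (frag_of ` S)" "z \<in> generate ?F (frag_of ` S)" for y z
      using g.m_closed[of y "- z"] g.m_inv_closed[of z] that by simp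
  qed (blast intro: generate.incl)
  then show ?thesis
    using F.generate_incl[OF sub] by auto
qed

lemma subgroup_free_Abelian_group_closed:
  assumes "subgroup N (free_Abelian_group S)"
  shows "0 \<in> N" and "x \<in> N \<Longrightarrow> - x \<in> N" and "x \<in> N \<Longrightarrow> y \<in> N \<Longrightarrow> x + y \<in> N"
    and "(\<And>i. i \<in> I \<Longrightarrow> u i \<in> N) \<Longrightarrow> sum u I \<in> N"
proof -
  show zero: "0 \<in> N"
    using subgroup.one_closed[OF assms] by simp
  show "- x \<in> N" if "x \<in> N" for x
    using subgroup.m_inv_closed[OF assms that] subgroup.mem_carrier[OF assms that] by simp
  show add: "x + y \<in> N" if "x \<in> N" "y \<in> N" for x y
    using subgroup.m_closed[OF assms that] by simp
  show "(\<And>i. i \<in> I \<Longrightarrow> u i \<in> N) \<Longrightarrow> sum u I \<in> N"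
    by (induction I rule: infinite_finite_induct) (auto intro: zero add)
qed

lemma frag_extend_hom:
  assumes "\<And>s. s \<in> S \<Longrightarrow> f s \<in> carrier (free_Abelian_group T)"
  shows "frag_extend f \<in> hom (free_Abelian_group S) (free_Abelian_group T)"
proof (rule homI)
  fix x assume "x \<in> carrier (free_Abelian_group S)"
  then show "frag_extend f x \<in> carrier (free_Abelian_group T)"
    using assms keys_frag_extend[of f x] by fastforce
qed (simp add: frag_extend_add)


section \<open>Conjugation and blow-up of symbols\<close>

context finite_group
begin

section \<open>Conjugation of subgroups, characters and symbols\<close>

abbreviation (input) conj_by :: "'a \<Rightarrow> 'a \<Rightarrow> 'a" where
  "conj_by g x \<equiv> g \<otimes> x \<otimes> inv g"

lemma conj_by_mult:
  "g \<in> carrier G \<Longrightarrow> x \<in> carrier G \<Longrightarrow> y \<in> carrier G \<Longrightarrow>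
   conj_by g (x \<otimes> y) = conj_by g x \<otimes> conj_by g y"
  by (simp add: m_assoc inv_solve_left inv_solve_left')

lemma conj_by_inv: "g \<in> carrier G \<Longrightarrow> x \<in> carrier G \<Longrightarrow> inv g \<otimes> conj_by g x \<otimes> g = x"
  by (simp add: m_assoc inv_solve_left inv_solve_left')

lemma conj_set_subgroup:
  assumes "subgroup H G" "g \<in> carrier G"
  shows "subgroup (conj_set G g H) G"
proof -
  have "conj_by g \<in> hom G G"
    using assms by (intro homI) (simp_all only: conj_by_mult m_closed inv_closed)
  then interpret group_hom G G "conj_by g"
    by unfold_locales
  show ?thesis
    unfolding conj_set_def using subgroup_img_is_subgroup[OF assms(1)] .
qed

lemma conj_set_mono: "K \<subseteq> H \<Longrightarrow> conj_set G g K \<subseteq> conj_set G g H"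
  by (auto simp: conj_set_def)

lemma conj_set_inv:
  assumes "g \<in> carrier G" "H \<subseteq> carrier G"
  shows "conj_set G (inv g) (conj_set G g H) = H"
proof -
  have "inv g \<otimes> conj_by g x \<otimes> inv (inv g) = x" if "x \<in> H" for x
    using that assms by (simp add: conj_by_inv subset_iff)
  then show ?thesis
    by (simp add: conj_set_def image_image)
qed

text \<open>Conjugation by the inverse element is the inverse bijection. This reindexes Psi of a
  conjugated symbol as a sum over the subgroups of H.\<close>

lemma conj_set_bij_betw:
  assumes H: "subgroup H G" and g: "g \<in> carrier G"
  shows "bij_betw (conj_set G g) {K. subgroup K (G\<lparr>carrier := H\<rparr>)}
    {K. subgroup K (G\<lparr>carrier := conj_set G g H\<rparr>)}"
proof -
  note sub = subgroup.subset
  have inv': "conj_set G g (conj_set G (inv g) K) = K" if "subgroup K G" for K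
    using conj_set_inv[of "inv g" K] g sub[OF that] by simp
  show ?thesis
  proof (rule bij_betw_byWitness[where f' = "conj_set G (inv g)"])
    show "conj_set G g ` {K. subgroup K (G\<lparr>carrier := H\<rparr>)} \<subseteq> {K. subgroup K (G\<lparr>carrier := conj_set G g H\<rparr>)}"
      using H g by (auto simp: subgroup_of_subgroup_iff conj_set_subgroup intro: subsetD[OF conj_set_mono])
    have "conj_set G (inv g) K \<subseteq> H" if "K \<subseteq> conj_set G g H" for K
      using conj_set_mono[OF that, of "inv g"] conj_set_inv[OF g sub[OF H]] by simp
    then show "conj_set G (inv g) ` {K. subgroup K (G\<lparr>carrier := conj_set G g H\<rparr>)} \<subseteq> {K. subgroup K (G\<lparr>carrier := H\<rparr>)}"
      using H g by (auto simp: subgroup_of_subgroup_iff conj_set_subgroup)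
  qed (use H g in \<open>simp_all add: subgroup_of_subgroup_iff conj_set_subgroup conj_set_inv sub inv'\<close>)
qed

lemma conj_char_apply:
  "g \<in> carrier G \<Longrightarrow> H \<subseteq> carrier G \<Longrightarrow> x \<in> H \<Longrightarrow> conj_char G g H b (conj_by g x) = b x"
  by (auto simp: conj_char_def conj_set_def conj_by_inv subset_iff)

lemma conj_char_extensional: "conj_char G g H b \<in> extensional (conj_set G g H)"
  by (simp add: conj_char_def)

lemma conj_char_inv:
  assumes "g \<in> carrier G" "H \<subseteq> carrier G" "b \<in> extensional H"
  shows "conj_char G (inv g) (conj_set G g H) (conj_char G g H b) = b"
proof (rule extensionalityI)
  show "conj_char G (inv g) (conj_set G g H) (conj_char G g H b) \<in> extensional H"
    using conj_char_extensional[of "inv g" "conj_set G g H"] conj_set_inv[OF assms(1,2)] by simp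
  show "conj_char G (inv g) (conj_set G g H) (conj_char G g H b) x = b x" if "x \<in> H" for x
    using that conj_set_inv[OF assms(1,2)] conj_char_apply[OF assms(1,2) that, of b] assms(1)
    by (simp add: conj_char_def[of G "inv g"])
qed (fact assms(3))

lemma conj_char_one:
  assumes "g \<in> carrier G" "H \<subseteq> carrier G"
  shows "conj_char G g H \<one>\<^bsub>dual G H\<^esub> = \<one>\<^bsub>dual G (conj_set G g H)\<^esub>"
proof (rule extensionalityI[of _ "conj_set G g H"])
  show "conj_char G g H \<one>\<^bsub>dual G H\<^esub> y = \<one>\<^bsub>dual G (conj_set G g H)\<^esub> y" if "y \<in> conj_set G g H" for y
    using that assms conj_char_apply[OF assms, of _ "\<one>\<^bsub>dual G H\<^esub>"] by (auto simp: conj_set_def one_dual)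
qed (simp_all add: conj_char_extensional one_dual)

lemma conj_char_closed:
  assumes "g \<in> carrier G" "subgroup H G" "b \<in> carrier (dual G H)"
  shows "conj_char G g H b \<in> carrier (dual G (conj_set G g H))"
proof -
  have H: "H \<subseteq> carrier G"
    using assms subgroup.subset by blast
  note app = conj_char_apply[OF assms(1) H, of _ b]
  have "conj_char G g H b (conj_by g x \<otimes> conj_by g y) =
      conj_char G g H b (conj_by g x) * conj_char G g H b (conj_by g y)" if "x \<in> H" "y \<in> H" for x y
  proof -
    have "conj_char G g H b (conj_by g x \<otimes> conj_by g y) = conj_char G g H b (conj_by g (x \<otimes> y))"
      using that H assms(1) conj_by_mult[of g x y] by (simp add: subset_iff)
    then show ?thesis
      using that assms app[of "x \<otimes> y"] app[of x] app[of y] subgroup.m_closed[OF assms(2)]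
      by (simp add: dual_carrier_iff)
  qed
  moreover have "conj_char G g H b (conj_by g x) \<noteq> 0" if "x \<in> H" for x
    using that assms app[of x] by (simp add: dual_carrier_iff)
  ultimately show ?thesis
    unfolding dual_carrier_iff by (simp add: conj_char_extensional) (simp add: conj_set_def)
qed

lemma conj_char_hom:
  assumes "g \<in> carrier G" "subgroup H G"
  shows "group_hom (dual G H) (dual G (conj_set G g H)) (conj_char G g H)"
proof -
  have H: "H \<subseteq> carrier G"
    using assms subgroup.subset by blast
  have "conj_char G g H (b \<otimes>\<^bsub>dual G H\<^esub> c) = conj_char G g H b \<otimes>\<^bsub>dual G (conj_set G g H)\<^esub> conj_char G g H c" for b c
  proof (rule extensionalityI[of _ "conj_set G g H"])
    fix y assume "y \<in> conj_set G g H"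
    then obtain x where x: "x \<in> H" "y = conj_by g x" "conj_by g x \<in> conj_set G g H"
      by (auto simp: conj_set_def)
    then show "conj_char G g H (b \<otimes>\<^bsub>dual G H\<^esub> c) y = (conj_char G g H b \<otimes>\<^bsub>dual G (conj_set G g H)\<^esub> conj_char G g H c) y"
      using conj_char_apply[OF assms(1) H x(1)] by (simp add: mult_dual)
  qed (simp_all add: conj_char_extensional mult_dual)
  then have "conj_char G g H \<in> hom (dual G H) (dual G (conj_set G g H))"
    using assms by (intro homI conj_char_closed) auto
  then show ?thesis
    using assms comm_group_dual conj_set_subgroup
    by (simp add: group_hom_def group_hom_axioms_def comm_group.axioms)
qed

lemma conj_char_surj:
  assumes "g \<in> carrier G" "subgroup H G"
  shows "conj_char G g H ` carrier (dual G H) = carrier (dual G (conj_set G g H))"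
proof
  have H: "H \<subseteq> carrier G"
    using assms subgroup.subset by blast
  show "carrier (dual G (conj_set G g H)) \<subseteq> conj_char G g H ` carrier (dual G H)"
  proof
    fix c assume c: "c \<in> carrier (dual G (conj_set G g H))"
    let ?b = "conj_char G (inv g) (conj_set G g H) c"
    have "?b \<in> carrier (dual G H)"
      using conj_char_closed[OF _ conj_set_subgroup[OF assms(2,1)] c, of "inv g"] assms(1)
      by (simp add: conj_set_inv[OF assms(1) H])
    moreover have "conj_char G g H ?b = c"
      using conj_char_inv[of "inv g" "conj_set G g H" c] assms c H
        subgroup.subset[OF conj_set_subgroup[OF assms(2,1)]]
      by (simp add: conj_set_inv dual_carrier_iff)
    ultimately show "c \<in> conj_char G g H ` carrier (dual G H)"
      by force
  qed
qed (use assms conj_char_closed in blast)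

text \<open>Because conjugation and restriction commute, a (C) relator restricts to a (C) relator
  with the same g.\<close>

lemma conj_char_restrict:
  assumes "g \<in> carrier G" "H \<subseteq> carrier G" "K \<subseteq> H"
  shows "restrict (conj_char G g H b) (conj_set G g K) = conj_char G g K (restrict b K)"
proof (rule extensionalityI[of _ "conj_set G g K"])
  fix y assume "y \<in> conj_set G g K"
  then obtain x where x: "x \<in> K" "y = conj_by g x" "conj_by g x \<in> conj_set G g K"
    by (auto simp: conj_set_def)
  then show "restrict (conj_char G g H b) (conj_set G g K) y = conj_char G g K (restrict b K) y"
    using conj_char_apply[of g H x b] conj_char_apply[of g K x "restrict b K"] assms by auto
qed (simp_all add: conj_char_extensional)

lemma abelian_subgroups_iff:
  "H \<in> abelian_subgroups G \<longleftrightarrow> subgroup H G \<and> (\<forall>x\<in>H. \<forall>y\<in>H. x \<otimes> y = y \<otimes> x)"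
  using subgroup_imp_group[of H] comm_groupE(4)[of "G\<lparr>carrier := H\<rparr>"]
  by (auto simp: abelian_subgroups_def intro!: group.group_comm_groupI)

lemma conj_commute:
  "g \<in> carrier G \<Longrightarrow> x \<in> carrier G \<Longrightarrow> y \<in> carrier G \<Longrightarrow> x \<otimes> y = y \<otimes> x \<Longrightarrow>
   conj_by g x \<otimes> conj_by g y = conj_by g y \<otimes> conj_by g x"
  by (metis conj_by_mult)

text \<open>Commutation and generation are transported along conjugation. Entries stay nontrivial
  because conjugating back by the inverse sends a trivial character to a trivial one.\<close>

lemma conj_symbol:
  assumes s: "(H, Y, \<beta>) \<in> symbols G n" and g: "g \<in> carrier G"
  shows "(conj_set G g H, conj_set G g Y, map (conj_char G g H) \<beta>) \<in> symbols G n"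
proof -
  note sD = symbolsD[OF s]
  have H: "H \<subseteq> carrier G" and Y: "Y \<subseteq> carrier G" "H \<subseteq> Y" "Y \<subseteq> centralizer G H"
    using subgroup.subset[OF sD(2)] subgroup.subset[OF sD(3)] s by (auto simp: symbols_def)
  have "conj_set G g H \<in> abelian_subgroups G"
    using sD(1) H g conj_set_subgroup[OF sD(2) g] conj_commute[OF g]
    by (auto simp: abelian_subgroups_iff conj_set_def subset_iff)
  moreover have "conj_set G g Y \<subseteq> centralizer G (conj_set G g H)"
  proof
    fix z assume "z \<in> conj_set G g Y"
    then obtain y where y: "y \<in> Y" "z = conj_by g y"
      by (auto simp: conj_set_def)
    have "conj_by g y \<otimes> conj_by g x = conj_by g x \<otimes> conj_by g y" if "x \<in> H" for x
      using Y y H that g by (intro conj_commute) (auto simp: centralizer_def)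
    then show "z \<in> centralizer G (conj_set G g H)"
      using Y y g by (auto simp: centralizer_def conj_set_def)
  qed
  moreover have "conj_char G g H b \<noteq> \<one>\<^bsub>dual G (conj_set G g H)\<^esub>" if "b \<in> set \<beta>" for b
  proof
    assume eq: "conj_char G g H b = \<one>\<^bsub>dual G (conj_set G g H)\<^esub>"
    have "b = conj_char G (inv g) (conj_set G g H) (conj_char G g H b)"
      using that sD(4) g H by (subst conj_char_inv) (auto simp: dual_carrier_iff)
    also have "\<dots> = \<one>\<^bsub>dual G H\<^esub>"
      using eq conj_char_one[of "inv g" "conj_set G g H"] g H
        subgroup.subset[OF conj_set_subgroup[OF sD(2) g]]
      by (simp add: conj_set_inv)
    finally show False
      using that sD(5) by simp
  qed
  moreover have "generate (dual G (conj_set G g H)) (conj_char G g H ` set \<beta>) = carrier (dual G (conj_set G g H))"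
    using group_hom.generate_img[OF conj_char_hom[OF g sD(2)] sD(4)] sD(6) conj_char_surj[OF g sD(2)]
    by simp
  moreover have "conj_char G g H ` set \<beta> \<subseteq> carrier (dual G (conj_set G g H))"
    using sD(2,4) conj_char_closed[OF g] by blast
  ultimately show ?thesis
    using s conj_set_subgroup[OF sD(3) g] conj_set_mono[OF Y(2)] by (auto simp: symbols_def)
qed

lemma conj_restrict_chars:
  assumes "g \<in> carrier G" "H \<subseteq> carrier G" "K \<subseteq> H"
  shows "restrict_chars (map (conj_char G g H) \<beta>) (conj_set G g K) = map (conj_char G g K) (restrict_chars \<beta> K)"
  using assms by (simp add: restrict_chars_def conj_char_restrict)

section \<open>Reordering and blow-up of symbols, kernels of characters\<close>

lemma permute_symbol:
  assumes "(H, Y, \<beta>) \<in> symbols G n" "\<sigma> permutes {..<length \<beta>}"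
  shows "(H, Y, permute_list \<sigma> \<beta>) \<in> symbols G n"
  using assms by (simp add: symbols_def)

text \<open>The replaced entry is recovered from b1 = (b1 - b2) + b2 or b2 = (b2 - b1) + b1, so the
  new list still generates; the new entry is nontrivial since \<open>b1 \<noteq> b2\<close>.\<close>

lemma blowup_symbols:
  assumes s: "(H, Y, b1 # b2 # bs) \<in> symbols G n" and ne: "b1 \<noteq> b2"
  shows "(H, Y, char_minus G H b1 b2 # b2 # bs) \<in> symbols G n"
    and "(H, Y, b1 # char_minus G H b2 b1 # bs) \<in> symbols G n"
proof -
  note sD = symbolsD[OF s]
  interpret D: comm_group "dual G H"
    by (rule comm_group_dual[OF sD(2)])
  have b: "b1 \<in> carrier (dual G H)" "b2 \<in> carrier (dual G H)" "set bs \<subseteq> carrier (dual G H)"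
    using sD(4) by auto
  have generates: "generate (dual G H) A = carrier (dual G H)"
    if "A \<subseteq> carrier (dual G H)" "set (b1 # b2 # bs) \<subseteq> generate (dual G H) A" for A
    using that D.generate_incl[OF that(1)]
      D.generate_subgroup_incl[OF that(2) D.generate_is_subgroup[OF that(1)]] sD(6)
    by blast
  have recover: "b = char_minus G H b c \<otimes>\<^bsub>dual G H\<^esub> c"
    if "b \<in> carrier (dual G H)" "c \<in> carrier (dual G H)" for b c
    using that by (simp add: char_minus_def D.m_assoc)
  have "b1 \<in> generate (dual G H) (set (char_minus G H b1 b2 # b2 # bs))"
    by (subst recover[OF b(1,2)]) (intro generate.eng generate.incl; simp)
  then have gen1: "generate (dual G H) (set (char_minus G H b1 b2 # b2 # bs)) = carrier (dual G H)"
    using b char_minus_closed[OF sD(2) b(1,2)]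
    by (intro generates) (auto intro: generate.incl)
  have "b2 \<in> generate (dual G H) (set (b1 # char_minus G H b2 b1 # bs))"
    by (subst recover[OF b(2,1)]) (intro generate.eng generate.incl; simp)
  then have gen2: "generate (dual G H) (set (b1 # char_minus G H b2 b1 # bs)) = carrier (dual G H)"
    using b char_minus_closed[OF sD(2) b(2,1)]
    by (intro generates) (auto intro: generate.incl)
  show "(H, Y, char_minus G H b1 b2 # b2 # bs) \<in> symbols G n"
    using s gen1 ne char_minus_closed[OF sD(2) b(1,2)] char_minus_eq_one_iff[OF sD(2) b(1,2)]
    by (simp add: symbols_def)
  show "(H, Y, b1 # char_minus G H b2 b1 # bs) \<in> symbols G n"
    using s gen2 ne char_minus_closed[OF sD(2) b(2,1)] char_minus_eq_one_iff[OF sD(2) b(2,1)]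
    by (simp add: symbols_def)
qed

lemma kernel_char_subgroup:
  assumes "subgroup H G" "c \<in> carrier (dual G H)"
  shows "subgroup (kernel (G\<lparr>carrier := H\<rparr>) complex_units c) G"
proof -
  interpret H: subgroup H G by fact
  have c: "c (x \<otimes> y) = c x * c y" if "x \<in> H" "y \<in> H" for x y
    using assms(2) that by (simp add: dual_carrier_iff)
  have one: "c \<one> = 1"
    using c[of \<one> \<one>] assms(2) by (simp add: dual_carrier_iff)
  have inv: "c (inv x) * c x = 1" if "x \<in> H" for x
    using c[of "inv x" x] that one by simp
  show ?thesis
  proof
    show "inv x \<in> kernel (G\<lparr>carrier := H\<rparr>) complex_units c" if "x \<in> kernel (G\<lparr>carrier := H\<rparr>) complex_units c" for x
      using that inv[of x] by (simp add: kernel_def complex_units_def)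
  qed (use H.subset in \<open>auto simp: kernel_def complex_units_def c one\<close>)
qed

lemma kernel_char_iff:
  assumes "subgroup H G" "b1 \<in> carrier (dual G H)" "b2 \<in> carrier (dual G H)" "K \<subseteq> H"
  shows "K \<subseteq> kernel (G\<lparr>carrier := H\<rparr>) complex_units (char_minus G H b1 b2) \<longleftrightarrow> restrict b1 K = restrict b2 K"
proof -
  have "b1 x / b2 x = 1 \<longleftrightarrow> b1 x = b2 x" if "x \<in> H" for x
    using that assms(3) by (simp add: dual_carrier_iff)
  then have "K \<subseteq> kernel (G\<lparr>carrier := H\<rparr>) complex_units (char_minus G H b1 b2) \<longleftrightarrow> (\<forall>x\<in>K. b1 x = b2 x)"
    using assms(4) by (auto simp: kernel_def complex_units_def char_minus_eq[OF is_group assms(1,3)])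
  also have "\<dots> \<longleftrightarrow> restrict b1 K = restrict b2 K"
    by (metis restrict_apply' restrict_ext)
  finally show ?thesis .
qed

text \<open>The restriction homomorphism to the kernel of c kills c, hence the whole cyclic group
  generated by c. With c = b1 - b2 this explains the case distinction of (B2).\<close>

lemma generate_char_restrict_kernel:
  assumes H: "subgroup H G" and c: "c \<in> carrier (dual G H)" and b: "b \<in> generate (dual G H) {c}"
  shows "restrict b (kernel (G\<lparr>carrier := H\<rparr>) complex_units c) =
    \<one>\<^bsub>dual G (kernel (G\<lparr>carrier := H\<rparr>) complex_units c)\<^esub>"
proof -
  define K where "K = kernel (G\<lparr>carrier := H\<rparr>) complex_units c"
  have K: "subgroup K G" "K \<subseteq> H"
    unfolding K_def using kernel_char_subgroup[OF H c] by (auto simp: kernel_def)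
  interpret r: group_hom "dual G H" "dual G K" "\<lambda>b. restrict b K"
    by (rule restrict_hom[OF H K])
  have "restrict c K = \<one>\<^bsub>dual G K\<^esub>"
    by (auto simp: one_dual K_def kernel_def complex_units_def restrict_def)
  then have "{c} \<subseteq> kernel (dual G H) (dual G K) (\<lambda>b. restrict b K)"
    using c by (simp add: kernel_def)
  then have "b \<in> kernel (dual G H) (dual G K) (\<lambda>b. restrict b K)"
    using b r.G.generate_subgroup_incl[OF _ r.subgroup_kernel] by blast
  then show ?thesis
    by (simp add: kernel_def K_def)
qed

end


section \<open>Relators\<close>

text \<open>A reordering relator is its own partner. The predicate is separate from
  \<open>relator_pair\<close> so that the triangular argument also applies to (O) alone; the index H
  drives the well-founded induction.\<close>

inductive reorder_pair ::
  "('a, 'b) monoid_scheme \<Rightarrow> nat \<Rightarrow> 'a set \<Rightarrow> ('a symb \<Rightarrow>\<^sub>0 int) \<Rightarrow> ('a symb \<Rightarrow>\<^sub>0 int) \<Rightarrow> bool"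
  for G n where
  reorder: "(H, Y, \<beta>) \<in> symbols G n \<Longrightarrow> \<sigma> permutes {..<length \<beta>} \<Longrightarrow>
    r = symb G H Y \<beta> - symb G H Y (permute_list \<sigma> \<beta>) \<Longrightarrow> reorder_pair G n H r r"

text \<open>
  Pairs of a relator of \<open>BC\<close> and the corresponding relator of \<open>BC'\<close>, indexed by
  the abelian group of their leading symbols. The case \<open>H = 1\<close> of (V) is left out since the
  trivial group has no nontrivial characters and hence no symbols.
\<close>

inductive relator_pair ::
  "('a, 'b) monoid_scheme \<Rightarrow> nat \<Rightarrow> 'a set \<Rightarrow> ('a symb \<Rightarrow>\<^sub>0 int) \<Rightarrow> ('a symb \<Rightarrow>\<^sub>0 int) \<Rightarrow> bool"
  for G n where
  O: "reorder_pair G n H r r' \<Longrightarrow> relator_pair G n H r r'"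
| C: "(H, Y, \<beta>) \<in> symbols G n \<Longrightarrow> g \<in> carrier G \<Longrightarrow>
    r = symb G H Y \<beta> - symb G (conj_set G g H) (conj_set G g Y) (map (conj_char G g H) \<beta>) \<Longrightarrow>
    relator_pair G n H r r"
| V: "(H, Y, \<beta>) \<in> symbols G n \<Longrightarrow> i < length \<beta> \<Longrightarrow> j < length \<beta> \<Longrightarrow> i \<noteq> j \<Longrightarrow>
    \<beta> ! i \<otimes>\<^bsub>dual G H\<^esub> \<beta> ! j = \<one>\<^bsub>dual G H\<^esub> \<Longrightarrow>
    relator_pair G n H (symb G H Y \<beta>) (symb G H Y \<beta>)"
| B2_eq: "(H, Y, b # b # bs) \<in> symbols G n \<Longrightarrow> r = symb G H Y (b # b # bs) - symb G H Y (b # bs) \<Longrightarrow>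
    relator_pair G n H r r"
| B2: "(H, Y, b1 # b2 # bs) \<in> symbols G n \<Longrightarrow> b1 \<noteq> b2 \<Longrightarrow>
    H' = kernel (G\<lparr>carrier := H\<rparr>) complex_units (char_minus G H b1 b2) \<Longrightarrow>
    r' = symb G H Y (b1 # b2 # bs) - blowup_terms G H Y b1 b2 bs \<Longrightarrow>
    r = r' - symb G H' Y (restrict_chars (b1 # b2 # bs) H') \<Longrightarrow>
    relator_pair G n H r r'"

lemma Psi_free_diff: "Psi_free G (x - y) = Psi_free G x - Psi_free G y"
  by (simp add: Psi_free_def frag_extend_diff)

lemma Psi_free_add: "Psi_free G (x + y) = Psi_free G x + Psi_free G y"
  by (simp add: Psi_free_def frag_extend_add)

lemma free_diff_carrier:
  "x \<in> carrier (free_Abelian_group S) \<Longrightarrow> y \<in> carrier (free_Abelian_group S) \<Longrightarrow>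
   x - y \<in> carrier (free_Abelian_group S)"
  using keys_diff[of x y] by auto

context finite_group
begin

text \<open>Only second components are collected: errors are measured by relators of the modified
  group over proper subgroups.\<close>

abbreviation lower_relators where
  "lower_relators n H \<equiv> {s'. \<exists>K s. (K, H) \<in> finite_psubset \<and> relator_pair G n K s s'}"

lemma trivial_symbol: "({\<one>}, Y, \<beta>) \<notin> symbols G n"
proof
  assume s: "({\<one>}, Y, \<beta>) \<in> symbols G n"
  then obtain b where b: "b \<in> set \<beta>"
    by (cases \<beta>) (auto simp: symbols_def)
  then have b': "b \<in> carrier (dual G {\<one>})"
    using symbolsD(4)[OF s] by blast
  then have "b \<one> = b \<one> * b \<one>" "b \<one> \<noteq> 0"
    by (metis dual_carrier_iff insertI1 l_one one_closed)+
  then have "b \<one> = 1"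
    by simp
  then have "b = \<one>\<^bsub>dual G {\<one>}\<^esub>"
    using b' by (auto simp: one_dual dual_carrier_iff extensional_def)
  then show False
    using b symbolsD(5)[OF s] by simp
qed

lemma Psi_free_symb_subgroups:
  "subgroup H G \<Longrightarrow> Psi_free G (symb G H Y \<beta>) =
     (\<Sum>K | subgroup K G \<and> K \<subseteq> H. symb G K Y (restrict_chars \<beta> K))"
  by (simp add: Psi_free_symb subgroup_of_subgroup_iff)

text \<open>T K stands for a symbol or relator restricted to K. The top term is the expected partner
  and everything below it is an error in N; all triangularity statements about Psi reduce to
  this.\<close>

lemma sum_subgroups_minus_top:
  assumes H: "subgroup H G" and N: "subgroup N (free_symbols G n)"
    and T: "\<And>K. subgroup K G \<Longrightarrow> K \<subset> H \<Longrightarrow> T K \<in> N"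
  shows "(\<Sum>K | subgroup K G \<and> K \<subseteq> H. T K) - T H \<in> N"
proof -
  have "(\<Sum>K | subgroup K G \<and> K \<subseteq> H. T K) = T H + (\<Sum>K\<in>{K. subgroup K G \<and> K \<subseteq> H} - {H}. T K)"
    using H by (intro sum.remove finite_subgroups) auto
  moreover have "(\<Sum>K\<in>{K. subgroup K G \<and> K \<subseteq> H} - {H}. T K) \<in> N"
    using T by (intro subgroup_free_Abelian_group_closed(4)[OF N]) blast
  ultimately show ?thesis
    by simp
qed

lemma rel_O_eq: "rel_O G n = {r. \<exists>H r'. reorder_pair G n H r r'}"
  "rel_O G n = {r'. \<exists>H r. reorder_pair G n H r r'}"
  unfolding rel_O_def by (auto simp: reorder_pair.simps)

section \<open>Restriction of relators to subgroups\<close>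

lemma reorder_pair_carrier:
  "reorder_pair G n H r r' \<Longrightarrow> r \<in> carrier (free_symbols G n) \<and> r' \<in> carrier (free_symbols G n)"
  by (elim reorder_pair.cases) (simp only: free_diff_carrier symb_in_carrier permute_symbol conj_absorb)

text \<open>Restriction acts entrywise, hence commutes with permuting the list. Both lists have the
  same entries, so the zero convention kills both symbols or neither.\<close>

lemma reorder_pair_restrict:
  assumes "(H, Y, \<beta>) \<in> symbols G n" "\<sigma> permutes {..<length \<beta>}" "subgroup K G" "K \<subseteq> H"
    and T: "T = symb G K Y (restrict_chars \<beta> K) - symb G K Y (restrict_chars (permute_list \<sigma> \<beta>) K)"
  shows "T = 0 \<or> reorder_pair G n K T T"
proof -
  have eq: "restrict_chars (permute_list \<sigma> \<beta>) K = permute_list \<sigma> (restrict_chars \<beta> K)"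
    using assms(2) by (simp add: restrict_chars_def permute_list_map)
  have set: "set (restrict_chars (permute_list \<sigma> \<beta>) K) = set (restrict_chars \<beta> K)"
    using assms(2) by simp
  show ?thesis
  proof (rule symb_restrict_cases[OF assms(1,3,4)])
    assume "\<one>\<^bsub>dual G K\<^esub> \<in> set (restrict_chars \<beta> K)"
    then have "T = 0"
      unfolding T by (metis set symb_eq_0 diff_zero)
    then show ?thesis ..
  next
    assume "(K, Y, restrict_chars \<beta> K) \<in> symbols G n"
    then show ?thesis
      using assms(2) by (intro disjI2 reorder_pair.intros[where \<sigma> = \<sigma>]) (simp_all add: T eq)
  qed
qed

text \<open>Conjugation preserves the trivial character, so a trivial entry on K kills both symbols
  of the relator. Otherwise the same g gives a (C) relator over K.\<close>

lemma restrict_relator_C: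
  assumes s: "(H, Y, \<beta>) \<in> symbols G n" and g: "g \<in> carrier G" and K: "subgroup K G" "K \<subseteq> H"
    and T: "T = symb G K Y (restrict_chars \<beta> K) -
      symb G (conj_set G g K) (conj_set G g Y) (restrict_chars (map (conj_char G g H) \<beta>) (conj_set G g K))"
  shows "T = 0 \<or> relator_pair G n K T T"
proof -
  have H: "H \<subseteq> carrier G"
    using symbolsD(2)[OF s] subgroup.subset by blast
  have T': "T = symb G K Y (restrict_chars \<beta> K) -
      symb G (conj_set G g K) (conj_set G g Y) (map (conj_char G g K) (restrict_chars \<beta> K))"
    using T by (simp only: conj_restrict_chars[OF g H K(2)])
  show ?thesis
  proof (rule symb_restrict_cases[OF s K])
    assume one: "\<one>\<^bsub>dual G K\<^esub> \<in> set (restrict_chars \<beta> K)"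
    have "\<one>\<^bsub>dual G (conj_set G g K)\<^esub> \<in> conj_char G g K ` set (restrict_chars \<beta> K)"
      using one K(2) H by (metis conj_char_one g image_eqI subset_trans)
    then have "T = 0"
      using one by (simp add: T' symb_eq_0 del: set_restrict_chars)
    then show ?thesis ..
  next
    assume "(K, Y, restrict_chars \<beta> K) \<in> symbols G n"
    then show ?thesis
      using g T' by (blast intro: relator_pair.C)
  qed
qed

text \<open>Restriction is a homomorphism, so the opposite entries at i and j stay opposite.\<close>

lemma restrict_relator_V:
  assumes s: "(H, Y, \<beta>) \<in> symbols G n" and K: "subgroup K G" "K \<subseteq> H"
    and ij: "i < length \<beta>" "j < length \<beta>" "i \<noteq> j" "\<beta> ! i \<otimes>\<^bsub>dual G H\<^esub> \<beta> ! j = \<one>\<^bsub>dual G H\<^esub>"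
    and T: "T = symb G K Y (restrict_chars \<beta> K)"
  shows "T = 0 \<or> relator_pair G n K T T"
proof (rule symb_restrict_cases[OF s K])
  interpret r: group_hom "dual G H" "dual G K" "\<lambda>b. restrict b K"
    by (rule restrict_hom[OF symbolsD(2)[OF s] K])
  assume sK: "(K, Y, restrict_chars \<beta> K) \<in> symbols G n"
  have "\<beta> ! i \<in> carrier (dual G H)" "\<beta> ! j \<in> carrier (dual G H)"
    using symbolsD(4)[OF s] ij by auto
  then have "restrict_chars \<beta> K ! i \<otimes>\<^bsub>dual G K\<^esub> restrict_chars \<beta> K ! j = \<one>\<^bsub>dual G K\<^esub>"
    using ij r.hom_mult[of "\<beta> ! i" "\<beta> ! j"] by (simp add: restrict_chars_def)
  then show ?thesis
    unfolding T using sK ij by (intro disjI2 relator_pair.V) auto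
qed (simp add: T)

lemma drop_duplicate_symbol: "(H, Y, b # b # bs) \<in> symbols G n \<Longrightarrow> (H, Y, b # bs) \<in> symbols G n"
  by (simp add: symbols_def)

lemma restrict_relator_B2_eq:
  assumes s: "(H, Y, b # b # bs) \<in> symbols G n" and K: "subgroup K G" "K \<subseteq> H"
    and T: "T = symb G K Y (restrict_chars (b # b # bs) K) - symb G K Y (restrict_chars (b # bs) K)"
  shows "T = 0 \<or> relator_pair G n K T T"
proof (rule symb_restrict_cases[OF s K])
  assume "\<one>\<^bsub>dual G K\<^esub> \<in> set (restrict_chars (b # b # bs) K)"
  then have "T = 0"
    by (simp add: T symb_eq_0)
  then show ?thesis ..
next
  assume "(K, Y, restrict_chars (b # b # bs) K) \<in> symbols G n"
  then show ?thesis
    unfolding T by (intro disjI2 relator_pair.B2_eq[where b = "restrict b K"]) simp_all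
qed

text \<open>Supplies the opposite entries c and -c that turn a degenerate blow-up relator into a (V)
  relator.\<close>

lemma char_minus_one_cancel:
  assumes "subgroup K G" "c \<in> carrier (dual G K)"
  shows "char_minus G K \<one>\<^bsub>dual G K\<^esub> c \<otimes>\<^bsub>dual G K\<^esub> c = \<one>\<^bsub>dual G K\<^esub>"
    and "c \<otimes>\<^bsub>dual G K\<^esub> char_minus G K \<one>\<^bsub>dual G K\<^esub> c = \<one>\<^bsub>dual G K\<^esub>"
proof -
  interpret D: comm_group "dual G K"
    by (rule comm_group_dual[OF assms(1)])
  show "char_minus G K \<one>\<^bsub>dual G K\<^esub> c \<otimes>\<^bsub>dual G K\<^esub> c = \<one>\<^bsub>dual G K\<^esub>"
    "c \<otimes>\<^bsub>dual G K\<^esub> char_minus G K \<one>\<^bsub>dual G K\<^esub> c = \<one>\<^bsub>dual G K\<^esub>"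
    using assms(2) by (simp_all add: char_minus_def)
qed

text \<open>Since the restrictions of \<open>b1\<close> and \<open>b2\<close> differ, at most one of
  them is trivial. If all entries are nontrivial, T is a (B2') relator; a trivial entry of the tail
  kills all three symbols. If one of the first two entries is trivial, a single blow-up symbol
  survives with a minus sign, and it is a (V) relator; this is the origin of
  \<open>- T\<close>.\<close>

lemma restrict_relator_B2:
  assumes s: "(H, Y, b1 # b2 # bs) \<in> symbols G n" and K: "subgroup K G" "K \<subseteq> H"
    and ne: "restrict b1 K \<noteq> restrict b2 K"
    and T: "T = symb G K Y (restrict_chars (b1 # b2 # bs) K) -
      blowup_terms G K Y (restrict b1 K) (restrict b2 K) (restrict_chars bs K)"
  shows "T = 0 \<or> (\<exists>s. relator_pair G n K s T) \<or> (\<exists>s. relator_pair G n K s (- T))"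
proof -
  note sD = symbolsD[OF s]
  define c1 c2 cs where c: "c1 = restrict b1 K" "c2 = restrict b2 K" "cs = restrict_chars bs K"
  have c_dual: "c1 \<in> carrier (dual G K)" "c2 \<in> carrier (dual G K)"
    using sD(4) K restrict_dual by (auto simp: c)
  have b_dual: "b1 \<in> carrier (dual G H)" "b2 \<in> carrier (dual G H)"
    using sD(4) by auto
  have c_ne: "c1 \<noteq> c2" and b_ne: "b1 \<noteq> b2"
    using ne by (auto simp: c)
  have T: "T = symb G K Y (c1 # c2 # cs) -
      (symb G K Y (char_minus G K c1 c2 # c2 # cs) + symb G K Y (c1 # char_minus G K c2 c1 # cs))"
    using T by (simp add: c blowup_terms_def)
  \<comment> \<open>Hence the entries created by the blow-up never trigger the zero
    convention.\<close>
  have minus_nz: "char_minus G K c1 c2 \<noteq> \<one>\<^bsub>dual G K\<^esub>" "char_minus G K c2 c1 \<noteq> \<one>\<^bsub>dual G K\<^esub>"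
    using char_minus_eq_one_iff[OF K(1)] c_dual c_ne by auto
  note blow = blowup_symbols[OF s b_ne]
  have r1: "restrict_chars (char_minus G H b1 b2 # b2 # bs) K = char_minus G K c1 c2 # c2 # cs"
    and r2: "restrict_chars (b1 # char_minus G H b2 b1 # bs) K = c1 # char_minus G K c2 c1 # cs"
    using restrict_char_minus[OF sD(2) K] b_dual by (simp_all add: c)
  consider "\<one>\<^bsub>dual G K\<^esub> \<notin> {c1, c2} \<union> set cs" | "\<one>\<^bsub>dual G K\<^esub> \<in> set cs"
    | "\<one>\<^bsub>dual G K\<^esub> = c1" "\<one>\<^bsub>dual G K\<^esub> \<notin> set cs" | "\<one>\<^bsub>dual G K\<^esub> = c2" "\<one>\<^bsub>dual G K\<^esub> \<notin> set cs"
    by auto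
  then show ?thesis
  proof cases
    case 1
    then have "(K, Y, c1 # c2 # cs) \<in> symbols G n"
      using restrict_symbol[OF s K] by (simp add: c)
    then show ?thesis
      using c_ne T unfolding blowup_terms_def[symmetric] by (blast intro: relator_pair.B2)
  next
    case 2
    then show ?thesis
      by (simp add: T symb_eq_0)
  next
    \<comment> \<open>Here c1 - c2 = -c2 stands next to c2, while the other two symbols contain the
      trivial \<open>c1\<close> and vanish.\<close>
    case 3
    then have sym: "(K, Y, char_minus G K c1 c2 # c2 # cs) \<in> symbols G n"
      using restrict_symbol[OF blow(1) K] minus_nz c_ne unfolding r1 by auto
    have "- T = symb G K Y (char_minus G K c1 c2 # c2 # cs)"
      using 3 by (simp add: T symb_eq_0)
    moreover have "char_minus G K c1 c2 \<otimes>\<^bsub>dual G K\<^esub> c2 = \<one>\<^bsub>dual G K\<^esub>"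
      using char_minus_one_cancel(1)[OF K(1) c_dual(2)] 3 by simp
    ultimately show ?thesis
      using relator_pair.V[OF sym, of 0 1] by auto
  next
    case 4
    then have sym: "(K, Y, c1 # char_minus G K c2 c1 # cs) \<in> symbols G n"
      using restrict_symbol[OF blow(2) K] minus_nz c_ne unfolding r2 by auto
    have "- T = symb G K Y (c1 # char_minus G K c2 c1 # cs)"
      using 4 by (simp add: T symb_eq_0)
    moreover have "c1 \<otimes>\<^bsub>dual G K\<^esub> char_minus G K c2 c1 = \<one>\<^bsub>dual G K\<^esub>"
      using char_minus_one_cancel(2)[OF K(1) c_dual(1)] 4 by simp
    ultimately show ?thesis
      using relator_pair.V[OF sym, of 0 1] by auto
  qed
qed

section \<open>Comparison of the relator pairs with the defining relations\<close>

lemma kernel_symb_eq_0: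
  assumes s: "(H, Y, b1 # b2 # bs) \<in> symbols G n"
    and b: "\<exists>b\<in>set (b1 # b2 # bs). b \<in> generate (dual G H) {char_minus G H b1 b2}"
    and K: "K = kernel (G\<lparr>carrier := H\<rparr>) complex_units (char_minus G H b1 b2)"
  shows "symb G K Y (restrict_chars (b1 # b2 # bs) K) = 0"
proof -
  have c: "char_minus G H b1 b2 \<in> carrier (dual G H)"
    using symbolsD(2,4)[OF s] by (intro char_minus_closed) auto
  obtain b where b: "b \<in> set (b1 # b2 # bs)" "b \<in> generate (dual G H) {char_minus G H b1 b2}"
    using b by blast
  have "restrict b K \<in> (\<lambda>b. restrict b K) ` set (b1 # b2 # bs)"
    using b(1) by (rule imageI)
  then show ?thesis
    using generate_char_restrict_kernel[OF symbolsD(2)[OF s] c b(2)] unfolding K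
    by (intro symb_eq_0) (simp only: set_restrict_chars)
qed

text \<open>The split into equal and distinct leading characters mirrors the constructors
  \<open>B2_eq\<close> and \<open>B2\<close>, whose first components are exactly these
  elements.\<close>

lemma rel_B2_eq:
  "rel_B2 G n = {r. \<exists>H Y b bs. (H, Y, b # b # bs) \<in> symbols G n \<and> r = symb G H Y (b # b # bs) - symb G H Y (b # bs)} \<union>
    {r. \<exists>H Y b1 b2 bs K. (H, Y, b1 # b2 # bs) \<in> symbols G n \<and> b1 \<noteq> b2 \<and>
      K = kernel (G\<lparr>carrier := H\<rparr>) complex_units (char_minus G H b1 b2) \<and>
      r = symb G H Y (b1 # b2 # bs) - blowup_terms G H Y b1 b2 bs - symb G K Y (restrict_chars (b1 # b2 # bs) K)}"
    (is "_ = ?A \<union> ?B")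
proof -
  define rhs where "rhs H Y b1 b2 bs = (if b1 = b2 then symb G H Y (b2 # bs)
      else if \<exists>b\<in>set (b1 # b2 # bs). b \<in> generate (dual G H) {char_minus G H b1 b2}
      then blowup_terms G H Y b1 b2 bs
      else
        let H' = kernel (G\<lparr>carrier := H\<rparr>) complex_units (char_minus G H b1 b2)
        in blowup_terms G H Y b1 b2 bs + symb G H' Y (restrict_chars (b1 # b2 # bs) H'))" for H Y b1 b2 bs
  have eq: "rel_B2 G n = {symb G H Y (b1 # b2 # bs) - rhs H Y b1 b2 bs | H Y b1 b2 bs. (H, Y, b1 # b2 # bs) \<in> symbols G n}"
    unfolding rel_B2_def rhs_def ..
  have rhs_eq: "rhs H Y b b bs = symb G H Y (b # bs)" for H Y b bs
    by (simp add: rhs_def)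
  have rhs_ne: "symb G H Y (b1 # b2 # bs) - rhs H Y b1 b2 bs =
      symb G H Y (b1 # b2 # bs) - blowup_terms G H Y b1 b2 bs - symb G K Y (restrict_chars (b1 # b2 # bs) K)"
    if "(H, Y, b1 # b2 # bs) \<in> symbols G n" "b1 \<noteq> b2"
      "K = kernel (G\<lparr>carrier := H\<rparr>) complex_units (char_minus G H b1 b2)" for H Y b1 b2 bs K
    using that(2,3) kernel_symb_eq_0[OF that(1) _ that(3)]
    by (simp add: rhs_def Let_def diff_diff_eq del: restrict_chars_Cons set_simps)
  show ?thesis
  proof (intro equalityI subsetI)
    fix r assume "r \<in> rel_B2 G n"
    then obtain H Y b1 b2 bs where *: "(H, Y, b1 # b2 # bs) \<in> symbols G n" "r = symb G H Y (b1 # b2 # bs) - rhs H Y b1 b2 bs"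
      unfolding eq by blast
    show "r \<in> ?A \<union> ?B"
    proof (cases "b1 = b2")
      case True
      then have "(H, Y, b2 # b2 # bs) \<in> symbols G n \<and> r = symb G H Y (b2 # b2 # bs) - symb G H Y (b2 # bs)"
        using * by (simp add: rhs_eq)
      then show ?thesis
        by blast
    next
      case False
      then have "r \<in> ?B"
        unfolding *(2) rhs_ne[OF *(1) False refl] using *(1) by blast
      then show ?thesis ..
    qed
  next
    fix r assume "r \<in> ?A \<union> ?B"
    then show "r \<in> rel_B2 G n"
    proof
      assume "r \<in> ?A"
      then obtain H Y b bs where "(H, Y, b # b # bs) \<in> symbols G n"
        "r = symb G H Y (b # b # bs) - rhs H Y b b bs"
        unfolding rhs_eq by blast
      then show ?thesis
        unfolding eq by blast
    next
      assume "r \<in> ?B"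
      then obtain H Y b1 b2 bs K where *: "(H, Y, b1 # b2 # bs) \<in> symbols G n" "b1 \<noteq> b2"
        "K = kernel (G\<lparr>carrier := H\<rparr>) complex_units (char_minus G H b1 b2)"
        "r = symb G H Y (b1 # b2 # bs) - blowup_terms G H Y b1 b2 bs - symb G K Y (restrict_chars (b1 # b2 # bs) K)"
        by blast
      then have "r = symb G H Y (b1 # b2 # bs) - rhs H Y b1 b2 bs"
        by (simp only: rhs_ne[OF *(1-3)])
      then show ?thesis
        unfolding eq using *(1) by blast
    qed
  qed
qed

lemma rel_V_iff:
  "r \<in> rel_V G n \<longleftrightarrow> (\<exists>H Y \<beta> i j. (H, Y, \<beta>) \<in> symbols G n \<and> i < length \<beta> \<and> j < length \<beta> \<and> i \<noteq> j \<and>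
     \<beta> ! i \<otimes>\<^bsub>dual G H\<^esub> \<beta> ! j = \<one>\<^bsub>dual G H\<^esub> \<and> r = symb G H Y \<beta>)"
  unfolding rel_V_def using trivial_symbol by blast

lemma rel_C_iff:
  "r \<in> rel_C G n \<longleftrightarrow> (\<exists>H Y \<beta> g. (H, Y, \<beta>) \<in> symbols G n \<and> g \<in> carrier G \<and>
     r = symb G H Y \<beta> - symb G (conj_set G g H) (conj_set G g Y) (map (conj_char G g H) \<beta>))"
  unfolding rel_C_def by blast

lemma rel_B2'_eq:
  "rel_B2' G n = {r. \<exists>H Y b bs. (H, Y, b # b # bs) \<in> symbols G n \<and> r = symb G H Y (b # b # bs) - symb G H Y (b # bs)} \<union>
    {r. \<exists>H Y b1 b2 bs. (H, Y, b1 # b2 # bs) \<in> symbols G n \<and> b1 \<noteq> b2 \<and>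
      r = symb G H Y (b1 # b2 # bs) - blowup_terms G H Y b1 b2 bs}" (is "_ = ?A \<union> ?B")
proof (intro equalityI subsetI)
  fix r assume "r \<in> rel_B2' G n"
  then obtain H Y b1 b2 bs where *: "(H, Y, b1 # b2 # bs) \<in> symbols G n"
    "r = symb G H Y (b1 # b2 # bs) - (if b1 = b2 then symb G H Y (b2 # bs) else blowup_terms G H Y b1 b2 bs)"
    unfolding rel_B2'_def by blast
  show "r \<in> ?A \<union> ?B"
  proof (cases "b1 = b2")
    case True
    with * have "(H, Y, b2 # b2 # bs) \<in> symbols G n \<and> r = symb G H Y (b2 # b2 # bs) - symb G H Y (b2 # bs)"
      by simp
    then show ?thesis
      by blast
  next
    case False
    with * have "r = symb G H Y (b1 # b2 # bs) - blowup_terms G H Y b1 b2 bs"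
      by simp
    then show ?thesis
      using *(1) False by blast
  qed
next
  fix r assume "r \<in> ?A \<union> ?B"
  then obtain H Y b1 b2 bs where "(H, Y, b1 # b2 # bs) \<in> symbols G n"
    "r = symb G H Y (b1 # b2 # bs) - (if b1 = b2 then symb G H Y (b2 # bs) else blowup_terms G H Y b1 b2 bs)"
    by (smt (verit) Un_iff mem_Collect_eq)
  then show "r \<in> rel_B2' G n"
    unfolding rel_B2'_def by blast
qed

text \<open>Brings the relators of \<open>BC\<close>, with (O) adjoined, into the form that the
  triangular argument expects on its source side.\<close>

lemma relators_eq: "rel_O G n \<union> (rel_C G n \<union> rel_V G n \<union> rel_B2 G n) = {r. \<exists>H r'. relator_pair G n H r r'}"
proof (intro equalityI subsetI)
  fix r assume "r \<in> rel_O G n \<union> (rel_C G n \<union> rel_V G n \<union> rel_B2 G n)"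
  then show "r \<in> {r. \<exists>H r'. relator_pair G n H r r'}"
    unfolding rel_O_eq(1) rel_B2_eq
    by (simp only: Un_iff mem_Collect_eq rel_V_iff rel_C_iff) (blast intro: relator_pair.intros)
next
  fix r assume "r \<in> {r. \<exists>H r'. relator_pair G n H r r'}"
  then obtain H r' where "relator_pair G n H r r'"
    by blast
  then show "r \<in> rel_O G n \<union> (rel_C G n \<union> rel_V G n \<union> rel_B2 G n)"
  proof cases
    case O
    then have "r \<in> rel_O G n"
      unfolding rel_O_eq(1) by blast
    then show ?thesis
      by blast
  next
    case (C Y \<beta> g)
    then have "r \<in> rel_C G n"
      unfolding rel_C_iff by blast
    then show ?thesis
      by blast
  next
    case (V Y \<beta> i j)
    then have "r \<in> rel_V G n"
      unfolding rel_V_iff by blast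
    then show ?thesis
      by blast
  next
    case (B2_eq Y b bs)
    then have "r \<in> rel_B2 G n"
      unfolding rel_B2_eq by blast
    then show ?thesis
      by blast
  next
    case (B2 b1 b2 Y bs H')
    then have "r \<in> rel_B2 G n"
      unfolding rel_B2_eq by blast
    then show ?thesis
      by blast
  qed
qed

lemma relators_eq': "rel_O G n \<union> (rel_C G n \<union> rel_V G n \<union> rel_B2' G n) = {r'. \<exists>H r. relator_pair G n H r r'}"
proof (intro equalityI subsetI)
  fix r assume "r \<in> rel_O G n \<union> (rel_C G n \<union> rel_V G n \<union> rel_B2' G n)"
  then show "r \<in> {r'. \<exists>H r. relator_pair G n H r r'}"
    unfolding rel_O_eq(2) rel_B2'_eq
    by (simp only: Un_iff mem_Collect_eq rel_V_iff rel_C_iff) (blast intro: relator_pair.intros)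
next
  fix r' assume "r' \<in> {r'. \<exists>H r. relator_pair G n H r r'}"
  then obtain H r where "relator_pair G n H r r'"
    by blast
  then show "r' \<in> rel_O G n \<union> (rel_C G n \<union> rel_V G n \<union> rel_B2' G n)"
  proof cases
    case O
    then have "r' \<in> rel_O G n"
      unfolding rel_O_eq(2) by blast
    then show ?thesis
      by blast
  next
    case (C Y \<beta> g)
    then have "r' \<in> rel_C G n"
      unfolding rel_C_iff by blast
    then show ?thesis
      by blast
  next
    case (V Y \<beta> i j)
    then have "r' \<in> rel_V G n"
      unfolding rel_V_iff by blast
    then show ?thesis
      by blast
  next
    case (B2_eq Y b bs)
    then have "r' \<in> rel_B2' G n"
      unfolding rel_B2'_eq by blast
    then show ?thesis
      by blast
  next
    case (B2 b1 b2 Y bs H')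
    then have "r' \<in> rel_B2' G n"
      unfolding rel_B2'_eq by blast
    then show ?thesis
      by blast
  qed
qed

end


section \<open>The action of \<open>\<Psi>\<close> on relators\<close>

context finite_group
begin

lemma relator_pair_subgroup: "relator_pair G n H r r' \<Longrightarrow> subgroup H G"
  by (auto elim!: relator_pair.cases reorder_pair.cases dest: symbolsD(2))

lemma relator_pair_carrier:
  assumes "relator_pair G n H r r'"
  shows "r \<in> carrier (free_symbols G n)" "r' \<in> carrier (free_symbols G n)"
proof -
  have "r \<in> carrier (free_symbols G n) \<and> r' \<in> carrier (free_symbols G n)"
    using assms
  proof cases
    case O
    then show ?thesis
      by (rule reorder_pair_carrier)
  next
    case (C Y \<beta> g)
    then show ?thesis
      using conj_symbol by (simp only: free_diff_carrier symb_in_carrier)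
  next
    case (V Y \<beta> i j)
    then show ?thesis
      by (simp only: symb_in_carrier)
  next
    case (B2_eq Y b bs)
    then show ?thesis
      using drop_duplicate_symbol by (simp only: free_diff_carrier symb_in_carrier)
  next
    case (B2 Y b1 b2 bs K)
    have b: "b1 \<in> carrier (dual G H)" "b2 \<in> carrier (dual G H)"
      using symbolsD(4)[OF B2(1)] by auto
    have K: "subgroup K G" "K \<subseteq> H"
      using kernel_char_subgroup[OF symbolsD(2)[OF B2(1)] char_minus_closed[OF symbolsD(2)[OF B2(1)] b]] B2(3)
      by (auto simp: kernel_def)
    have "r' = symb G H Y (b1 # b2 # bs) - symb G H Y (char_minus G H b1 b2 # b2 # bs)
        - symb G H Y (b1 # char_minus G H b2 b1 # bs)"
      by (simp add: B2 blowup_terms_def)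
    then have "r' \<in> carrier (free_symbols G n)"
      using B2(1) blowup_symbols[OF B2(1,2)] by (simp only: free_diff_carrier symb_in_carrier)
    moreover have "r \<in> carrier (free_symbols G n)"
      unfolding B2(5)
      by (rule free_diff_carrier[OF calculation symb_restrict_in_carrier[OF B2(1) K]])
    ultimately show ?thesis
      by blast
  qed
  then show "r \<in> carrier (free_symbols G n)" "r' \<in> carrier (free_symbols G n)"
    by auto
qed

section \<open>Bijectivity of Psi on the free group\<close>

lemma Psi_free_hom: "Psi_free G \<in> hom (free_symbols G n) (free_symbols G n)"
  unfolding Psi_free_def
proof (rule frag_extend_hom)
  fix s assume "s \<in> symbols G n"
  moreover obtain H Y \<beta> where s: "s = (H, Y, \<beta>)"
    by (cases s)
  ultimately have "symb G K Y (restrict_chars \<beta> K) \<in> carrier (free_symbols G n)"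
    if "subgroup K (G\<lparr>carrier := H\<rparr>)" for K
    using that symb_restrict_in_carrier symbolsD(2) by (simp only: subgroup_of_subgroup_iff)
  then have "(\<Sum>K | subgroup K (G\<lparr>carrier := H\<rparr>). symb G K Y (restrict_chars \<beta> K)) \<in> carrier (free_symbols G n)"
    by (intro sum_closed_free_Abelian_group) blast
  then show "(case s of (H, Y, \<beta>) \<Rightarrow> \<Sum>K | subgroup K (G\<lparr>carrier := H\<rparr>). symb G K Y (restrict_chars \<beta> K))
      \<in> carrier (free_symbols G n)"
    by (simp only: s prod.case)
qed

lemma finite_psubset_iff: "subgroup H G \<Longrightarrow> (K, H) \<in> finite_psubset \<longleftrightarrow> K \<subset> H"
  using finite_subgroup by (auto simp: finite_psubset_def)

lemma Psi_free_minus_symb: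
  assumes "(H, Y, \<beta>) \<in> symbols G n"
  shows "Psi_free G (frag_of (H, Y, \<beta>)) - frag_of (H, Y, \<beta>) \<in>
    generate (free_symbols G n) {frag_of (K, Y', \<gamma>) | K Y' \<gamma>. (K, H) \<in> finite_psubset \<and> (K, Y', \<gamma>) \<in> symbols G n}"
    (is "_ \<in> generate _ ?X")
proof -
  note sD = symbolsD[OF assms]
  interpret F: group "free_symbols G n" by simp
  have N: "subgroup (generate (free_symbols G n) ?X) (free_symbols G n)"
    by (intro F.generate_is_subgroup) auto
  have "symb G K Y (restrict_chars \<beta> K) \<in> generate (free_symbols G n) ?X" if K: "subgroup K G" "K \<subset> H" for K
  proof (rule symb_restrict_cases[OF assms K(1)])
    assume "(K, Y, restrict_chars \<beta> K) \<in> symbols G n"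
    then show ?thesis
      using K finite_psubset_iff[OF sD(2)] by (simp only: symb_symbol) (blast intro: generate.incl)
  qed (use K subgroup_free_Abelian_group_closed(1)[OF N] in auto)
  then show ?thesis
    using sum_subgroups_minus_top[OF sD(2) N, of "\<lambda>K. symb G K Y (restrict_chars \<beta> K)"]
      Psi_free_symb_subgroups[OF sD(2), of Y \<beta>]
    by (simp add: symb_symbol[OF assms] restrict_chars_self[OF sD(4)])
qed

text \<open>The triangular argument for the basis, each generator being its own partner.\<close>

lemma Psi_free_surj: "Psi_free G ` carrier (free_symbols G n) = carrier (free_symbols G n)"
proof -
  interpret F: group "free_symbols G n" by simp
  define P :: "'a set \<Rightarrow> ('a symb \<Rightarrow>\<^sub>0 int) \<Rightarrow> ('a symb \<Rightarrow>\<^sub>0 int) \<Rightarrow> bool"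
    where "P H r r' \<longleftrightarrow> r = r' \<and> (\<exists>Y \<beta>. (H, Y, \<beta>) \<in> symbols G n \<and> r = frag_of (H, Y, \<beta>))" for H r r'
  have L: "{r. \<exists>H r'. P H r r'} = frag_of ` symbols G n" and R: "{r'. \<exists>H r. P H r r'} = frag_of ` symbols G n"
    by (force simp: P_def)+
  have "Psi_free G ` generate (free_symbols G n) {r. \<exists>H r'. P H r r'} =
      generate (free_symbols G n) {r'. \<exists>H r. P H r r'}"
  proof (rule F.image_generate_triangular[OF Psi_free_hom wf_finite_psubset])
    fix H r r' assume "P H r r'"
    then obtain Y \<beta> where s: "(H, Y, \<beta>) \<in> symbols G n" "r = frag_of (H, Y, \<beta>)" "r' = frag_of (H, Y, \<beta>)"
      by (auto simp: P_def)
    have "{s'. \<exists>K s. (K, H) \<in> finite_psubset \<and> P K s s'} =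
        {frag_of (K, Y', \<gamma>) | K Y' \<gamma>. (K, H) \<in> finite_psubset \<and> (K, Y', \<gamma>) \<in> symbols G n}"
      by (auto simp: P_def)
    then show "r \<in> carrier (free_symbols G n) \<and> r' \<in> carrier (free_symbols G n) \<and>
        Psi_free G r \<otimes>\<^bsub>free_symbols G n\<^esub> inv\<^bsub>free_symbols G n\<^esub> r' \<in>
          generate (free_symbols G n) {s'. \<exists>K s. (K, H) \<in> finite_psubset \<and> P K s s'}"
      using s Psi_free_minus_symb[OF s(1)] by simp
  qed
  then show ?thesis
    unfolding L R generate_frag_of .
qed

lemma Phi_Psi:
  assumes "x \<in> carrier (free_symbols G n)"
  shows "Phi_free G (Psi_free G x) = x"
proof (rule free_Abelian_group_induct[of x "symbols G n"])
  show "Phi_free G (Psi_free G (y - z)) = y - z"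
    if "Phi_free G (Psi_free G y) = y" "Phi_free G (Psi_free G z) = z" for y z
    using that by (simp add: Phi_free_def Psi_free_diff frag_extend_diff)
  show "Phi_free G (Psi_free G (frag_of s)) = frag_of s" if "s \<in> symbols G n" for s
    using that Phi_Psi_frag_of by (cases s) auto
qed (use assms in \<open>simp_all add: Phi_free_def Psi_free_def\<close>)

text \<open>Injectivity comes from the left inverse Phi, surjectivity from triangularity; together
  they make Phi a two-sided inverse.\<close>

lemma Psi_free_iso: "Psi_free G \<in> iso (free_symbols G n) (free_symbols G n)"
proof (rule isoI[OF Psi_free_hom])
  show "bij_betw (Psi_free G) (carrier (free_symbols G n)) (carrier (free_symbols G n))"
    using Psi_free_surj by (auto simp only: bij_betw_def intro: inj_on_inverseI[where g = "Phi_free G"] Phi_Psi)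
qed

section \<open>Unitriangularity of Psi on relators\<close>

text \<open>For descent to the symbols group the errors must stay within the reordering relators,
  which the statement for all relators does not provide.\<close>

lemma reorder_pair_lower:
  assumes "reorder_pair G n H r r'"
  shows "Psi_free G r - r' \<in>
    generate (free_symbols G n) {s'. \<exists>K s. (K, H) \<in> finite_psubset \<and> reorder_pair G n K s s'}"
    (is "_ \<in> generate _ ?X")
  using assms
proof cases
  case (reorder Y \<beta> \<sigma>)
  note sD = symbolsD[OF reorder(2)]
  interpret F: group "free_symbols G n" by simp
  have X: "?X \<subseteq> carrier (free_symbols G n)"
    using reorder_pair_carrier by blast
  have N: "subgroup (generate (free_symbols G n) ?X) (free_symbols G n)"
    by (rule F.generate_is_subgroup[OF X])
  define T where "T K = symb G K Y (restrict_chars \<beta> K) - symb G K Y (restrict_chars (permute_list \<sigma> \<beta>) K)" for K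
  have "T K \<in> generate (free_symbols G n) ?X" if K: "subgroup K G" "K \<subset> H" for K
  proof -
    have "T K = 0 \<or> reorder_pair G n K (T K) (T K)"
      using K by (intro reorder_pair_restrict[OF reorder(2,3)] T_def) auto
    then show ?thesis
      using K finite_psubset_iff[OF sD(2)] subgroup_free_Abelian_group_closed(1)[OF N]
      by (metis (mono_tags, lifting) generate.incl mem_Collect_eq)
  qed
  then have "(\<Sum>K | subgroup K G \<and> K \<subseteq> H. T K) - T H \<in> generate (free_symbols G n) ?X"
    by (rule sum_subgroups_minus_top[OF sD(2) N])
  moreover have "(\<Sum>K | subgroup K G \<and> K \<subseteq> H. T K) = Psi_free G r"
    by (simp add: reorder(4) T_def Psi_free_diff Psi_free_symb_subgroups[OF sD(2)] sum_subtractf)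
  moreover have "T H = r'"
    using sD(4) reorder(3) reorder(1)
    by (simp add: T_def reorder(4) restrict_chars_self)
  ultimately show ?thesis
    by simp
qed

text \<open>Outside the case (O), each case exhibits a family T of restricted relators such that Psi
  r is the sum of T K over all subgroups K of H, the top term T H is \<open>r'\<close>, and T K lies
  in the lower span for proper K.\<close>

lemma relator_pair_lower:
  assumes "relator_pair G n H r r'"
  shows "Psi_free G r - r' \<in> generate (free_symbols G n) (lower_relators n H)"
proof -
  interpret F: group "free_symbols G n" by simp
  have X: "lower_relators n H \<subseteq> carrier (free_symbols G n)"
    using relator_pair_carrier by blast
  define N where "N = generate (free_symbols G n) (lower_relators n H)"
  have N: "subgroup N (free_symbols G n)"
    unfolding N_def by (rule F.generate_is_subgroup[OF X])
  note N_closed = subgroup_free_Abelian_group_closed[OF N]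
  have H: "subgroup H G"
    using assms by (rule relator_pair_subgroup)
  have lower: "s' \<in> N" if "K \<subset> H" "relator_pair G n K s s'" for K s s'
    unfolding N_def using that finite_psubset_iff[OF H] by (intro generate.incl) blast
  have sum: "Psi_free G r - r' \<in> N"
    if "\<And>K. subgroup K G \<Longrightarrow> K \<subset> H \<Longrightarrow> T K \<in> N"
      "Psi_free G r = (\<Sum>K | subgroup K G \<and> K \<subseteq> H. T K)" "T H = r'" for T
    using sum_subgroups_minus_top[OF H N, of T] that by simp
  have "Psi_free G r - r' \<in> N"
    using assms
  proof cases
    case O
    have "generate (free_symbols G n) {s'. \<exists>K s. (K, H) \<in> finite_psubset \<and> reorder_pair G n K s s'} \<subseteq> N"
      unfolding N_def by (intro F.mono_generate) (blast intro: relator_pair.O)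
    then show ?thesis
      using reorder_pair_lower[OF O] by blast
  next
    case (C Y \<beta> g)
    note sD = symbolsD[OF C(2)]
    have HG: "H \<subseteq> carrier G"
      using H subgroup.subset by blast
    define S where "S K = symb G K (conj_set G g Y) (restrict_chars (map (conj_char G g H) \<beta>) K)" for K
    \<comment> \<open>Evaluating S at the conjugate of K makes both halves of the relator into sums
      over the subgroups of H.\<close>
    define T where "T K = symb G K Y (restrict_chars \<beta> K) - S (conj_set G g K)" for K
    show ?thesis
    proof (rule sum)
      fix K assume K: "subgroup K G" "K \<subset> H"
      then have "T K = 0 \<or> relator_pair G n K (T K) (T K)"
        by (intro restrict_relator_C[OF C(2,3)]) (auto simp: T_def S_def)
      then show "T K \<in> N"
        using lower[OF K(2)] N_closed(1) by auto
    next
      have "Psi_free G (symb G (conj_set G g H) (conj_set G g Y) (map (conj_char G g H) \<beta>)) =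
          (\<Sum>K | subgroup K (G\<lparr>carrier := H\<rparr>). S (conj_set G g K))"
        unfolding Psi_free_symb S_def by (rule sum.reindex_bij_betw[OF conj_set_bij_betw[OF H C(3)], symmetric])
      then show "Psi_free G r = (\<Sum>K | subgroup K G \<and> K \<subseteq> H. T K)"
        by (simp add: C(4) Psi_free_diff Psi_free_symb_subgroups[OF H] T_def sum_subtractf subgroup_of_subgroup_iff[OF H])
    next
      have "restrict_chars (map (conj_char G g H) \<beta>) (conj_set G g H) = map (conj_char G g H) \<beta>"
        using conj_restrict_chars[OF C(3) HG subset_refl] restrict_chars_self[OF sD(4)] by simp
      then show "T H = r'"
        using C(1,4) restrict_chars_self[OF sD(4)] by (simp add: T_def S_def)
    qed
  next
    case (V Y \<beta> i j)
    note sD = symbolsD[OF V(3)]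
    show ?thesis
    proof (rule sum)
      fix K assume K: "subgroup K G" "K \<subset> H"
      have "symb G K Y (restrict_chars \<beta> K) = 0 \<or>
          relator_pair G n K (symb G K Y (restrict_chars \<beta> K)) (symb G K Y (restrict_chars \<beta> K))"
        using K by (intro restrict_relator_V[OF V(3) _ _ V(4-7)]) auto
      then show "symb G K Y (restrict_chars \<beta> K) \<in> N"
        using lower[OF K(2)] N_closed(1) by auto
    qed (simp_all add: V Psi_free_symb_subgroups[OF H] restrict_chars_self[OF sD(4)])
  next
    case (B2_eq Y b bs)
    note sD = symbolsD[OF B2_eq(2)]
    define T where "T K = symb G K Y (restrict_chars (b # b # bs) K) - symb G K Y (restrict_chars (b # bs) K)" for K
    show ?thesis
    proof (rule sum)
      fix K assume K: "subgroup K G" "K \<subset> H"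
      have "T K = 0 \<or> relator_pair G n K (T K) (T K)"
        using K by (intro restrict_relator_B2_eq[OF B2_eq(2)] T_def) auto
      then show "T K \<in> N"
        using lower[OF K(2)] N_closed(1) by auto
    next
      show "Psi_free G r = (\<Sum>K | subgroup K G \<and> K \<subseteq> H. T K)"
        by (simp only: B2_eq(3) Psi_free_diff Psi_free_symb_subgroups[OF H] T_def sum_subtractf)
    next
      have "restrict_chars (b # bs) H = b # bs"
        using sD(4) by (intro restrict_chars_self) auto
      then show "T H = r'"
        using B2_eq(1,3) restrict_chars_self[OF sD(4)] by (simp only: T_def)
    qed
  next
    case (B2 Y b1 b2 bs H')
    note sD = symbolsD[OF B2(1)]
    have b: "b1 \<in> carrier (dual G H)" "b2 \<in> carrier (dual G H)"
      using sD(4) by auto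
    have H': "subgroup H' G" "H' \<subseteq> H"
      using kernel_char_subgroup[OF H char_minus_closed[OF H b]] B2(3) by (auto simp: kernel_def)
    have H'_iff: "K \<subseteq> H' \<longleftrightarrow> restrict b1 K = restrict b2 K" if "K \<subseteq> H" for K
      using kernel_char_iff[OF H b that] B2(3) by simp
    define S where "S K = symb G K Y (restrict_chars (b1 # b2 # bs) K)" for K
    define S1 where "S1 K = symb G K Y (restrict_chars (char_minus G H b1 b2 # b2 # bs) K)" for K
    define S2 where "S2 K = symb G K Y (restrict_chars (b1 # char_minus G H b2 b1 # bs) K)" for K
    \<comment> \<open>For K inside \<open>H'\<close> everything cancels: the kernel symbol and the
      leading symbol have the same restriction to K, and the blow-up terms vanish by
      \<open>S12_0\<close>.\<close>
    define T where "T K = (if K \<subseteq> H' then 0 else S K - (S1 K + S2 K))" for K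
    have S12: "S1 K + S2 K = blowup_terms G K Y (restrict b1 K) (restrict b2 K) (restrict_chars bs K)"
      if "subgroup K G" "K \<subseteq> H" for K
      using restrict_char_minus[OF H that] b by (simp add: S1_def S2_def blowup_terms_def)
    \<comment> \<open>On such K the characters \<open>b1\<close> and \<open>b2\<close> agree, so
      both differences restrict to the trivial character.\<close>
    have S12_0: "S1 K = 0 \<and> S2 K = 0" if "subgroup K G" "K \<subseteq> H'" for K
    proof -
      have KH: "K \<subseteq> H"
        using that H' by blast
      then have "restrict b1 K = restrict b2 K" "restrict b1 K \<in> carrier (dual G K)"
        using H'_iff that restrict_dual[OF KH that(1) b(1)] by auto
      then have "restrict b1 K = restrict b2 K"
        "char_minus G K (restrict b2 K) (restrict b2 K) = \<one>\<^bsub>dual G K\<^esub>"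
        using char_minus_eq_one_iff[OF that(1)] by auto
      then show ?thesis
        using restrict_char_minus[OF H that(1) KH] b by (simp add: S1_def S2_def symb_eq_0)
    qed
    show ?thesis
    proof (rule sum)
      fix K assume K: "subgroup K G" "K \<subset> H"
      then have KH: "K \<subseteq> H"
        by blast
      have "T K = 0 \<or> (\<exists>s. relator_pair G n K s (T K)) \<or> (\<exists>s. relator_pair G n K s (- T K))"
      proof (cases "K \<subseteq> H'")
        case False
        then have ne: "restrict b1 K \<noteq> restrict b2 K"
          using H'_iff[OF KH] by simp
        have "T K = symb G K Y (restrict_chars (b1 # b2 # bs) K) -
            blowup_terms G K Y (restrict b1 K) (restrict b2 K) (restrict_chars bs K)"
          using False S12[OF K(1) KH] by (simp only: T_def S_def if_False)
        then show ?thesis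
          by (rule restrict_relator_B2[OF B2(1) K(1) KH ne])
      qed (simp add: T_def)
      then show "T K \<in> N"
        using lower[OF K(2)] N_closed(1) N_closed(2)[of "- T K"] by auto
    next
      \<comment> \<open>Extended by zero, the sum coming from the kernel symbol can be compared term
        by term with the sums over subgroups of H.\<close>
      have "(\<Sum>K | subgroup K G \<and> K \<subseteq> H'. S K) = (\<Sum>K | subgroup K G \<and> K \<subseteq> H. if K \<subseteq> H' then S K else 0)"
        using H'(2) by (intro sum.mono_neutral_cong_left finite_subgroups) auto
      moreover have "Psi_free G (symb G H' Y (restrict_chars (b1 # b2 # bs) H')) = (\<Sum>K | subgroup K G \<and> K \<subseteq> H'. S K)"
        unfolding Psi_free_symb_subgroups[OF H'(1)] S_def
        by (intro sum.cong refl) (simp only: mem_Collect_eq restrict_chars_restrict_chars)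
      ultimately have "Psi_free G r =
          (\<Sum>K | subgroup K G \<and> K \<subseteq> H. S K - (S1 K + S2 K) - (if K \<subseteq> H' then S K else 0))"
        by (simp only: B2(4,5) blowup_terms_def Psi_free_diff Psi_free_add Psi_free_symb_subgroups[OF H]
            S_def[symmetric] S1_def[symmetric] S2_def[symmetric] sum_subtractf sum.distrib)
      also have "\<dots> = (\<Sum>K | subgroup K G \<and> K \<subseteq> H. T K)"
        using S12_0 by (intro sum.cong refl) (auto simp: T_def)
      finally show "Psi_free G r = (\<Sum>K | subgroup K G \<and> K \<subseteq> H. T K)" .
    next
      \<comment> \<open>Since \<open>b1 \<noteq> b2\<close> the kernel is proper, so the kernel
        symbol does not contribute at the top, and the top term is \<open>r'\<close> rather than
        \<open>r\<close>.\<close>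
      have "\<not> H \<subseteq> H'"
        using H'_iff[OF subset_refl] B2(2) b by (simp add: dual_carrier_iff extensional_restrict)
      then show "T H = r'"
        using S12[OF H subset_refl] b restrict_chars_self[OF sD(4)] restrict_chars_self[of bs H] sD(4)
        by (simp add: T_def S_def B2(4) dual_carrier_iff extensional_restrict)
    qed
  qed
  then show ?thesis
    unfolding N_def .
qed

text \<open>Equality makes the induced map on the symbols group injective, and it lets the left
  inverse Phi preserve the reordering span as well.\<close>

lemma Psi_free_O_subgroup: "Psi_free G ` O_subgroup G n = O_subgroup G n"
proof -
  interpret F: group "free_symbols G n" by simp
  have "Psi_free G ` generate (free_symbols G n) {r. \<exists>H r'. reorder_pair G n H r r'} =
      generate (free_symbols G n) {r'. \<exists>H r. reorder_pair G n H r r'}"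
  proof (rule F.image_generate_triangular[OF Psi_free_hom wf_finite_psubset])
    fix H r r' assume r: "reorder_pair G n H r r'"
    then show "r \<in> carrier (free_symbols G n) \<and> r' \<in> carrier (free_symbols G n) \<and>
        Psi_free G r \<otimes>\<^bsub>free_symbols G n\<^esub> inv\<^bsub>free_symbols G n\<^esub> r' \<in>
          generate (free_symbols G n) {s'. \<exists>K s. (K, H) \<in> finite_psubset \<and> reorder_pair G n K s s'}"
      using reorder_pair_lower[OF r] reorder_pair_carrier[OF r] by simp
  qed
  then show ?thesis
    unfolding O_subgroup_def rel_O_eq[symmetric] .
qed

lemma Psi_free_relators:
  "Psi_free G ` generate (free_symbols G n) (rel_O G n \<union> (rel_C G n \<union> rel_V G n \<union> rel_B2 G n)) =
    generate (free_symbols G n) (rel_O G n \<union> (rel_C G n \<union> rel_V G n \<union> rel_B2' G n))"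
proof -
  interpret F: group "free_symbols G n" by simp
  show ?thesis
    unfolding relators_eq relators_eq'
  proof (rule F.image_generate_triangular[OF Psi_free_hom wf_finite_psubset])
    fix H r r' assume r: "relator_pair G n H r r'"
    then show "r \<in> carrier (free_symbols G n) \<and> r' \<in> carrier (free_symbols G n) \<and>
        Psi_free G r \<otimes>\<^bsub>free_symbols G n\<^esub> inv\<^bsub>free_symbols G n\<^esub> r' \<in>
          generate (free_symbols G n) (lower_relators n H)"
      using relator_pair_lower[OF r] relator_pair_carrier[OF r] by simp
  qed
qed

end


section \<open>Descent to the quotients\<close>

context finite_group
begin

lemma rel_O_carrier: "rel_O G n \<subseteq> carrier (free_symbols G n)"
  unfolding rel_O_eq using reorder_pair_carrier by blast

lemma O_subgroup_subgroup: "subgroup (O_subgroup G n) (free_symbols G n)"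
  unfolding O_subgroup_def by (intro group.generate_is_subgroup rel_O_carrier) simp

lemma comm_group_SC: "comm_group (SC G n)"
  unfolding SC_def by (rule comm_group.abelian_FactGroup[OF abelian_free_Abelian_group O_subgroup_subgroup])

lemma proj_SC_hom: "group_hom (free_symbols G n) (SC G n) (proj_SC G n)"
proof -
  have "O_subgroup G n \<lhd> free_symbols G n"
    using comm_group.normal_iff_subgroup[OF abelian_free_Abelian_group] O_subgroup_subgroup by blast
  then have "proj_SC G n \<in> hom (free_symbols G n) (SC G n)"
    unfolding SC_def using normal.r_coset_hom_Mod by (simp add: proj_SC_def[abs_def])
  then show ?thesis
    using comm_group_SC by (simp add: group_hom_def group_hom_axioms_def comm_group.axioms)
qed

lemma SC_carrier: "carrier (SC G n) = proj_SC G n ` carrier (free_symbols G n)"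
  by (simp add: SC_def carrier_FactGroup proj_SC_def)

section \<open>Psi and Phi on the symbols group as direct images\<close>

text \<open>f maps a coset of \<open>O_subgroup G n\<close> onto another one, so all elements of X
  give the same class, and as a set this class is the direct image of X. This resolves the
  \<open>the_elem\<close> in \<open>Psi_SC\<close> and \<open>Phi_SC\<close>.\<close>

lemma the_elem_image_class:
  assumes X: "X \<in> carrier (SC G n)" and f: "f \<in> hom (free_symbols G n) (free_symbols G n)"
    and fO: "f ` O_subgroup G n = O_subgroup G n"
  shows "the_elem ((\<lambda>x. proj_SC G n (f x)) ` X) = f ` X"
proof -
  interpret F: comm_group "free_symbols G n"
    by (rule abelian_free_Abelian_group)
  interpret O: subgroup "O_subgroup G n" "free_symbols G n"
    by (rule O_subgroup_subgroup)
  obtain x where x: "x \<in> carrier (free_symbols G n)" "X = proj_SC G n x"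
    using X by (auto simp: SC_carrier)
  have img: "f ` proj_SC G n y = proj_SC G n (f y)" if "y \<in> carrier (free_symbols G n)" for y
    using hom_image_r_coset[OF f O.subset that] by (simp only: proj_SC_def fO)
  have "proj_SC G n y = X" "y \<in> carrier (free_symbols G n)" if "y \<in> X" for y
  proof -
    show "y \<in> carrier (free_symbols G n)"
      using that x F.r_coset_subset_G[OF O.subset x(1)] unfolding proj_SC_def by blast
    show "proj_SC G n y = X"
      using that x F.repr_independence[OF _ x(1) O.subgroup_axioms] unfolding proj_SC_def by metis
  qed
  then have "proj_SC G n (f y) = f ` X" if "y \<in> X" for y
    using img that by metis
  moreover have "x \<in> X"
    using F.rcos_self[OF x(1) O.subgroup_axioms] x(2) by (simp add: proj_SC_def)
  ultimately have "(\<lambda>x. proj_SC G n (f x)) ` X = {f ` X}"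
    by blast
  then show ?thesis
    by simp
qed

text \<open>That Phi stays in the free group is read off from surjectivity of Psi: every x is Psi y
  for some y of the free group, and Phi x is that y.\<close>

lemma Phi_free_hom: "Phi_free G \<in> hom (free_symbols G n) (free_symbols G n)"
proof (rule homI)
  fix x assume "x \<in> carrier (free_symbols G n)"
  then obtain y where "y \<in> carrier (free_symbols G n)" "x = Psi_free G y"
    using Psi_free_surj by blast
  then show "Phi_free G x \<in> carrier (free_symbols G n)"
    using Phi_Psi by simp
qed (simp add: Phi_free_def frag_extend_add)

lemma Phi_free_image_Psi_free:
  assumes "A \<subseteq> carrier (free_symbols G n)"
  shows "Phi_free G ` (Psi_free G ` A) = A"
proof -
  have "Phi_free G (Psi_free G x) = x" if "x \<in> A" for x
    using assms that by (intro Phi_Psi) blast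
  then show ?thesis
    by (simp add: image_image)
qed

lemma Phi_free_O_subgroup: "Phi_free G ` O_subgroup G n = O_subgroup G n"
  using Phi_free_image_Psi_free[OF subgroup.subset[OF O_subgroup_subgroup]]
  by (simp only: Psi_free_O_subgroup)

lemma Psi_SC_eq: "X \<in> carrier (SC G n) \<Longrightarrow> Psi_SC G n X = Psi_free G ` X"
  unfolding Psi_SC_def by (rule the_elem_image_class[OF _ Psi_free_hom Psi_free_O_subgroup])

lemma Phi_SC_eq: "X \<in> carrier (SC G n) \<Longrightarrow> Phi_SC G n X = Phi_free G ` X"
  unfolding Phi_SC_def by (rule the_elem_image_class[OF _ Phi_free_hom Phi_free_O_subgroup])

lemma Psi_SC_iso: "(`) (Psi_free G) \<in> iso (SC G n) (SC G n)"
  using image_iso_FactGroup[OF abelian_free_Abelian_group abelian_free_Abelian_group Psi_free_iso O_subgroup_subgroup]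
  by (simp only: SC_def Psi_free_O_subgroup)

lemma Psi_Phi_SC:
  assumes "X \<in> carrier (SC G n)"
  shows "Phi_free G ` X \<in> carrier (SC G n)" "Psi_free G ` (Phi_free G ` X) = X"
proof -
  have "(`) (Psi_free G) ` carrier (SC G n) = carrier (SC G n)"
    using Psi_SC_iso[of n] by (simp add: iso_def bij_betw_def)
  then obtain Z where Z: "Z \<in> carrier (SC G n)" "X = Psi_free G ` Z"
    using assms by blast
  have "Z \<subseteq> carrier (free_symbols G n)"
    using Z(1) monoid.r_coset_subset_G[OF group.is_monoid[OF group_free_Abelian_group] subgroup.subset[OF O_subgroup_subgroup]]
    by (auto simp: SC_carrier proj_SC_def simp del: carrier_free_Abelian_group_iff)
  then have "Phi_free G ` X = Z"
    using Z(2) Phi_free_image_Psi_free by simp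
  then show "Phi_free G ` X \<in> carrier (SC G n)" "Psi_free G ` (Phi_free G ` X) = X"
    using Z by simp_all
qed

text \<open>Reordering relators project to the neutral element, so adjoining them upstairs does not
  change the span below. This translates the two-stage quotient into a single span in the free
  group.\<close>

lemma generate_proj_SC:
  assumes "rel_O G n \<union> A \<subseteq> carrier (free_symbols G n)"
  shows "generate (SC G n) (proj_SC G n ` A) = proj_SC G n ` generate (free_symbols G n) (rel_O G n \<union> A)"
proof -
  interpret p: group_hom "free_symbols G n" "SC G n" "proj_SC G n"
    by (rule proj_SC_hom)
  have "proj_SC G n x = \<one>\<^bsub>SC G n\<^esub>" if "x \<in> rel_O G n" for x
    using that group.coset_join2[OF group_free_Abelian_group _ O_subgroup_subgroup, of x] rel_O_carrier
    by (auto simp: proj_SC_def SC_def O_subgroup_def simp del: carrier_free_Abelian_group_iff intro: generate.incl)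
  then have sub: "proj_SC G n ` A \<subseteq> proj_SC G n ` (rel_O G n \<union> A)"
    "proj_SC G n ` (rel_O G n \<union> A) \<subseteq> insert \<one>\<^bsub>SC G n\<^esub> (proj_SC G n ` A)"
    by auto
  have "proj_SC G n ` A \<subseteq> carrier (SC G n)"
    using assms by (auto simp: SC_carrier)
  then have "generate (SC G n) (proj_SC G n ` A) = generate (SC G n) (proj_SC G n ` (rel_O G n \<union> A))"
    using p.H.mono_generate[OF sub(1)] p.H.mono_generate[OF sub(2)] p.H.generate_insert_one by blast
  then show ?thesis
    using p.generate_img[OF assms] by simp
qed

lemma relators_carrier:
  "rel_O G n \<union> (rel_C G n \<union> rel_V G n \<union> rel_B2 G n) \<subseteq> carrier (free_symbols G n)"
  "rel_O G n \<union> (rel_C G n \<union> rel_V G n \<union> rel_B2' G n) \<subseteq> carrier (free_symbols G n)"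
  unfolding relators_eq relators_eq' using relator_pair_carrier by blast+

lemma BC_subgroup_subgroup: "subgroup (BC_subgroup G n) (SC G n)"
proof -
  interpret SC: comm_group "SC G n"
    by (rule comm_group_SC)
  show ?thesis
    unfolding BC_subgroup_def SC_carrier using relators_carrier(1)[of n]
    by (intro SC.generate_is_subgroup) (simp only: SC_carrier image_mono Un_subset_iff)
qed

text \<open>Both subgroups are projections of spans in the free group that Psi already matches, and
  the projection commutes with direct images because Psi preserves the reordering span.\<close>

lemma Psi_BC_subgroup: "(`) (Psi_free G) ` BC_subgroup G n = BC'_subgroup G n"
proof -
  let ?R = "generate (free_symbols G n) (rel_O G n \<union> (rel_C G n \<union> rel_V G n \<union> rel_B2 G n))"
  have R: "?R \<subseteq> carrier (free_symbols G n)"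
    by (rule group.generate_incl[OF group_free_Abelian_group relators_carrier(1)])
  have "Psi_free G ` proj_SC G n x = proj_SC G n (Psi_free G x)" if "x \<in> ?R" for x
    using hom_image_r_coset[OF Psi_free_hom subgroup.subset[OF O_subgroup_subgroup]] that R
    by (auto simp only: proj_SC_def Psi_free_O_subgroup)
  then have "(`) (Psi_free G) ` (proj_SC G n ` ?R) = proj_SC G n ` (Psi_free G ` ?R)"
    by (simp add: image_image)
  then show ?thesis
    unfolding BC_subgroup_def BC'_subgroup_def generate_proj_SC[OF relators_carrier(1)]
      generate_proj_SC[OF relators_carrier(2)] Psi_free_relators .
qed

end

theorem theorem5p2:
  fixes G :: "('a, 'b) monoid_scheme" and n :: nat
  assumes "group G" and "finite (carrier G)" and "1 \<le> n"
  shows "\<exists>\<Psi> \<in> hom (BC G n) (BC' G n).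
    (\<forall>X \<in> carrier (SC G n). \<Psi> (proj_BC G n X) = proj_BC' G n (Psi_SC G n X)) \<and>
    \<Psi> \<in> iso (BC G n) (BC' G n) \<and>
    (\<forall>X \<in> carrier (SC G n).
       inv_into (carrier (BC G n)) \<Psi> (proj_BC' G n X) = proj_BC G n (Phi_SC G n X))"
proof -
  interpret finite_group G
    using assms(1,2) by (simp add: finite_group_def finite_group_axioms_def)
  \<comment> \<open>An element of \<open>BC G n\<close> is a set of classes, each of which is a set
    of elements of the free group; hence the nested direct image.\<close>
  define \<Psi> where "\<Psi> = (`) ((`) (Psi_free G))"
  have iso: "\<Psi> \<in> iso (BC G n) (BC' G n)"
    using image_iso_FactGroup[OF comm_group_SC comm_group_SC Psi_SC_iso BC_subgroup_subgroup]
    by (simp only: \<Psi>_def BC_def BC'_def Psi_BC_subgroup)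
  have Psi: "\<Psi> (proj_BC G n X) = proj_BC' G n (Psi_free G ` X)" if "X \<in> carrier (SC G n)" for X
    using hom_image_r_coset[OF iso_imp_homomorphism[OF Psi_SC_iso] subgroup.subset[OF BC_subgroup_subgroup] that]
    by (simp only: \<Psi>_def proj_BC_def proj_BC'_def Psi_BC_subgroup)
  \<comment> \<open>By injectivity it suffices that \<Psi> sends the claimed preimage to the class
    of X, which is the identity for Psi after Phi on the symbols group.\<close>
  have "inv_into (carrier (BC G n)) \<Psi> (proj_BC' G n X) = proj_BC G n (Phi_SC G n X)"
    if X: "X \<in> carrier (SC G n)" for X
  proof (rule inv_into_f_eq)
    show "inj_on \<Psi> (carrier (BC G n))"
      using iso by (simp add: iso_def bij_betw_def)
    show "proj_BC G n (Phi_SC G n X) \<in> carrier (BC G n)"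
      using Psi_Phi_SC(1)[OF X] by (simp add: BC_def carrier_FactGroup proj_BC_def Phi_SC_eq[OF X])
    show "\<Psi> (proj_BC G n (Phi_SC G n X)) = proj_BC' G n X"
      using Psi[OF Psi_Phi_SC(1)[OF X]] Psi_Phi_SC(2)[OF X] by (simp only: Phi_SC_eq[OF X])
  qed
  then show ?thesis
    using iso Psi Psi_SC_eq by (intro bexI[of _ \<Psi>]) (simp_all add: iso_def)
qed

end
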